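(* Let $m\ge1$ and $0<h<2$. Then $$\delta_m(h)=4\arccos\left(\frac h2\right)^{1/m}.$$ Moreover, let $\alpha\in(0,\pi)$ be defined by $h=2\sin^m\frac\alpha2$, and write $m=2n$ or $m=2n+1$. Set $x_{km}=\cos\frac{\pi(2k-1)}{2m}$, $a_{km}(\alpha)=1-2x_{km}^2\sin^2\frac\alpha2$ ($k=1,\dots,n$), $S_n(z)=\prod_{k=1}^n(z^2-2a_{km}(\alpha)z+1)$ (with $S_0\equiv1$), and $P^*_m=S_n$ if $m=2n$, $P^*_m(z)=(z-1)S_n(z)$ if $m=2n+1$. Then $P\in\mathfrak{P}_m(\Gamma)$ satisfies $\mathrm{mes}\{t\in\mathbb{T}:|P(e^{it})|\ge h\}=\delta_m(h)$ if and only if $P(z)=e^{im\theta}P^*_m(ze^{-i\theta})$ for some $\theta\in\mathbb{R}$.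
   Context: $\Gamma$ is the unit circle of $\mathbb{C}$; $\mathfrak{P}_m(\Gamma)$ is the set of polynomials $\prod_{j=1}^m(z-e^{i\phi_j})$, $\phi_j\in\mathbb{R}$. $\mathbb{T}=[0,2\pi)$ with endpoints identified, with Lebesgue measure $\mathrm{mes}$. For $0\le h\le2$, $\delta_m(h)=\inf\{\mathrm{mes}\{t\in\mathbb{T}:|P(e^{it})|\ge h\}:P\in\mathfrak{P}_m(\Gamma)\}$. The polynomial $e^{im\theta}P(ze^{-i\theta})$ is the rotation of $P$ by angle $\theta$ (its zeros are those of $P$ multiplied by $e^{i\theta}$). *)

theory Defs
  imports "HOL-Analysis.Analysis" "HOL-Computational_Algebra.Polynomial"
begin

definition unit_circle_polys :: "nat \<Rightarrow> complex poly set" where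
  "unit_circle_polys m = {P. \<exists>\<phi>::nat \<Rightarrow> real. P = (\<Prod>j<m. [:- cis (\<phi> j), 1:])}"

definition torus :: "real set" where
  "torus = {0..<2*pi}"

definition mes_ge :: "complex poly \<Rightarrow> real \<Rightarrow> real" where
  "mes_ge P h = measure lebesgue {t \<in> torus. cmod (poly P (cis t)) \<ge> h}"

definition delta :: "nat \<Rightarrow> real \<Rightarrow> real" where
  "delta m h = Inf ((\<lambda>P. mes_ge P h) ` unit_circle_polys m)"

definition x_coef :: "nat \<Rightarrow> nat \<Rightarrow> real" where
  "x_coef k m = cos (pi * (2 * real k - 1) / (2 * real m))"

definition a_coef :: "nat \<Rightarrow> nat \<Rightarrow> real \<Rightarrow> real" where
  "a_coef k m \<alpha> = 1 - 2 * (x_coef k m)^2 * (sin (\<alpha>/2))^2"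

definition S_poly :: "nat \<Rightarrow> nat \<Rightarrow> real \<Rightarrow> complex poly" where
  "S_poly n m \<alpha> = (\<Prod>k\<in>{1..n}. [:1, - 2 * complex_of_real (a_coef k m \<alpha>), 1:])"

definition P_star :: "nat \<Rightarrow> real \<Rightarrow> complex poly" where
  "P_star m \<alpha> = (if even m then S_poly (m div 2) m \<alpha>
                  else [:-1, 1:] * S_poly (m div 2) m \<alpha>)"

end

theory Submission
  imports Defs
begin

text \<open>
  On the unit circle \<open>\<bar>P\<bar>\<close> is the absolute value of a product \<open>T\<close> of \<open>m\<close> factors \<open>2 sin ((t - \<phi>\<^sub>j) / 2)\<close>.
  Let \<open>b\<close> be the measure of \<open>E = {\<bar>T\<bar> \<le> h}\<close>; the point is that \<open>sin (b/4) ^ m \<le> h/2\<close>.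
  If \<open>h < 2\<close> then \<open>\<bar>T\<bar>\<close> exceeds \<open>h\<close> at its maximum \<open>u\<close>. Moving roots and points alike by \<open>- \<epsilon> cot ((x - u)/2)\<close>
  multiplies \<open>T\<close> by \<open>exp (m \<epsilon>/2 + O(\<epsilon>\<^sup>2))\<close>, because \<open>cot x cot y = 1 + cot (x + y) (cot x + cot y)\<close> and \<open>u\<close>
  is a critical point, while \<open>E\<close> gains \<open>\<epsilon>\<close> times the integral over \<open>E\<close> of \<open>1/(2 sin\<^sup>2 ((x - u)/2))\<close>, which is
  at least \<open>2 tan (b/4)\<close>. To first order \<open>sin (b/4) ^ m / h\<close> therefore does not decrease, and for \<open>p < 1\<close> a maximum of
  \<open>sin (b/4) ^ m / h powr p\<close> can only occur at \<open>h = 2\<close>. In the extremal case \<open>E\<close> contains an arc of length \<open>b\<close>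
  centred opposite \<open>u\<close>. Between adjacent roots \<open>\<bar>T\<bar>\<close> must reach \<open>h\<close>, since otherwise spreading these two roots would
  enlarge \<open>E\<close>; so \<open>T\<close> equioscillates at \<open>m + 1\<close> points of the arc. Writing \<open>T\<close> as \<open>cos\<^sup>m (t/2)\<close> times a polynomial in
  \<open>tan (t/2)\<close>, two such functions on the same arc agree by the usual alternation argument.
\<close>

section \<open>Products of half-angle sines\<close>

definition sine_prod :: "nat \<Rightarrow> (nat \<Rightarrow> real) \<Rightarrow> real \<Rightarrow> real" where
  "sine_prod m \<phi> t = (\<Prod>j<m. 2 * sin ((t - \<phi> j) / 2))"

definition root_poly :: "nat \<Rightarrow> (nat \<Rightarrow> real) \<Rightarrow> complex poly" where
  "root_poly m \<phi> = (\<Prod>j<m. [:- cis (\<phi> j), 1:])"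

text \<open>The inequality is not strict: this makes the set closed and its measure upper
  semicontinuous in the roots and in \<open>h\<close>, so that maxima exist. The set complementary
  to the one measured by \<open>mes_ge\<close> is the strict version,
  \<open>strict_sublevel\<close>.\<close>

definition sublevel :: "nat \<Rightarrow> (nat \<Rightarrow> real) \<Rightarrow> real \<Rightarrow> real set" where
  "sublevel m \<phi> h = {t. \<bar>sine_prod m \<phi> t\<bar> \<le> h}"

definition sub_mes :: "nat \<Rightarrow> (nat \<Rightarrow> real) \<Rightarrow> real \<Rightarrow> real" where
  "sub_mes m \<phi> h = measure lebesgue (sublevel m \<phi> h \<inter> {0..<2*pi})"

lemma cis_diff_eq: "cis t - cis a = 2 * \<i> * cis ((t + a) / 2) * sin ((t - a) / 2)"
proof -
  have 1: "cos t - cos a = - 2 * sin ((t + a) / 2) * sin ((t - a) / 2)"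
    using sin_minus[of "(t - a) / 2"] by (simp add: cos_diff_cos minus_divide_left del: sin_minus)
  have 2: "sin t - sin a = 2 * cos ((t + a) / 2) * sin ((t - a) / 2)"
    by (simp add: sin_diff_sin)
  show ?thesis
    using 1 2 by (simp add: complex_eq_iff)
qed

lemma poly_root_poly: "poly (root_poly m \<phi>) z = (\<Prod>j<m. z - cis (\<phi> j))"
  by (simp add: root_poly_def poly_prod)

lemma poly_root_poly_cis:
  "poly (root_poly m \<phi>) (cis t) = (\<Prod>j<m. \<i> * cis ((t + \<phi> j) / 2)) * sine_prod m \<phi> t"
  unfolding poly_root_poly sine_prod_def of_real_prod prod.distrib[symmetric]
  by (rule prod.cong) (auto simp: cis_diff_eq)

lemma cmod_root_poly_cis: "cmod (poly (root_poly m \<phi>) (cis t)) = \<bar>sine_prod m \<phi> t\<bar>"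
  by (simp add: poly_root_poly_cis norm_mult prod_norm[symmetric])

lemma unit_circle_polys_eq: "unit_circle_polys m = range (root_poly m)"
  by (auto simp: unit_circle_polys_def root_poly_def)

lemma sine_prod_minus: "sine_prod m (\<lambda>j. \<phi> j - u) t = sine_prod m \<phi> (t + u)"
  by (simp add: sine_prod_def algebra_simps)

text \<open>Shifting an angle by \<open>2 * pi\<close> flips the sign of its factor, so the points
  \<open>cis (\<phi> j)\<close> determine the product only up to sign.\<close>

lemma sine_prod_abs_cong:
  assumes "\<And>j. j < m \<Longrightarrow> cis (\<phi> j) = cis (\<psi> j)"
  shows "\<bar>sine_prod m \<phi> t\<bar> = \<bar>sine_prod m \<psi> t\<bar>"
proof -
  have "root_poly m \<phi> = root_poly m \<psi>"
    using assms by (simp add: root_poly_def)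
  then show ?thesis
    by (metis cmod_root_poly_cis)
qed

lemma sine_prod_periodic: "\<bar>sine_prod m \<phi> (t + 2 * pi)\<bar> = \<bar>sine_prod m \<phi> t\<bar>"
  by (metis cmod_root_poly_cis cis_mult cis_2pi mult.right_neutral)

lemma sine_prod_periodic_int: "\<bar>sine_prod m \<phi> (t + 2 * pi * of_int k)\<bar> = \<bar>sine_prod m \<phi> t\<bar>"
proof -
  have "cis (t + 2 * pi * of_int k) = cis t"
    using cis_mult[of t "2 * pi * of_int k"] by (simp add: cis_multiple_2pi)
  then show ?thesis
    by (metis cmod_root_poly_cis)
qed

section \<open>Measure of sublevel sets over a period\<close>

lemma continuous_on_sine_prod [continuous_intros]: "continuous_on S (sine_prod m \<phi>)"
  unfolding sine_prod_def by (intro continuous_intros) auto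

lemma closed_sublevel: "closed (sublevel m \<phi> h)"
  unfolding sublevel_def
  by (intro closed_Collect_le continuous_intros)

lemma sublevel_measurable [measurable]: "sublevel m \<phi> h \<in> sets lebesgue"
  using borel_closed[OF closed_sublevel] by simp

lemma sublevel_bounded_lmeasurable [simp]: "sublevel m \<phi> h \<inter> {a..<b} \<in> lmeasurable"
  by (auto intro!: bounded_set_imp_lmeasurable bounded_Int)

text \<open>A window that starts in \<open>[0, p]\<close> is cut at \<open>p\<close>, and the piece
  beyond \<open>p\<close> is translated back by one period. Any other \<open>a\<close> differs from
  such a start by an integer multiple of \<open>p\<close>.\<close>

lemma periodic_measure_shift:
  fixes A :: "real set"
  assumes A: "A \<in> sets lebesgue" and p: "\<And>t. t + p \<in> A \<longleftrightarrow> t \<in> A" and "0 < p"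
  shows "measure lebesgue (A \<inter> {a..<a+p}) = measure lebesgue (A \<inter> {0..<p})"
proof -
  have m: "A \<inter> {x..<y} \<in> lmeasurable" for x y
    using A by (auto intro!: bounded_set_imp_lmeasurable bounded_Int)
  have 1: "measure lebesgue (A \<inter> {x+p..<y+p}) = measure lebesgue (A \<inter> {x..<y})" for x y
  proof -
    have "t \<in> (+) p ` (A \<inter> {x..<y})" if "t \<in> A \<inter> {x+p..<y+p}" for t
      using that p[of "t - p"] by (intro image_eqI[of _ _ "t - p"]) auto
    then have "A \<inter> {x+p..<y+p} = (+) p ` (A \<inter> {x..<y})"
      using p by (auto simp: add.commute)
    then show ?thesis
      by (simp add: measure_translation)
  qed
  have split: "measure lebesgue (A \<inter> {x..<z}) = measure lebesgue (A \<inter> {x..<y}) + measure lebesgue (A \<inter> {y..<z})"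
    if "x \<le> y" "y \<le> z" for x y z
  proof -
    have "A \<inter> {x..<z} = (A \<inter> {x..<y}) \<union> (A \<inter> {y..<z})"
      using that by auto
    moreover have "(A \<inter> {x..<y}) \<inter> (A \<inter> {y..<z}) = {}"
      by auto
    ultimately show ?thesis
      using measure_Un3[of "A \<inter> {x..<y}" lebesgue "A \<inter> {y..<z}"] m by simp
  qed
  have 2: "measure lebesgue (A \<inter> {x..<x+p}) = measure lebesgue (A \<inter> {0..<p})" if "0 \<le> x" "x \<le> p" for x
    using split[of x p "x+p"] split[of 0 x p] 1[of 0 x] that by simp
  have 3: "measure lebesgue (A \<inter> {x + real n * p..<x + real n * p + p}) = measure lebesgue (A \<inter> {x..<x+p})" for x n
  proof (induction n)
    case (Suc n)
    then show ?case
      using 1[of "x + real n * p" "x + real n * p + p"] by (simp add: algebra_simps)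
  qed simp
  define k where "k = \<lfloor>a / p\<rfloor>"
  define r where "r = a - of_int k * p"
  have "of_int k \<le> a / p" "a / p < of_int k + 1"
    by (auto simp: k_def)
  then have r: "0 \<le> r" "r \<le> p"
    using \<open>0 < p\<close> by (auto simp: r_def field_simps)
  show ?thesis
  proof (cases "k \<ge> 0")
    case True
    then show ?thesis
      using 3[of r "nat k"] 2[OF r] by (simp add: r_def)
  next
    case False
    then have "real (nat (- k)) = - of_int k"
      by simp
    then show ?thesis
      using 3[of a "nat (- k)"] 2[OF r] by (simp add: r_def)
  qed
qed

lemma sub_mes_window: "sub_mes m \<phi> h = measure lebesgue (sublevel m \<phi> h \<inter> {a..<a+2*pi})"
  unfolding sub_mes_def
  by (rule periodic_measure_shift[symmetric, OF sublevel_measurable]) (auto simp: sublevel_def sine_prod_periodic)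

lemma sub_mes_rotate: "sub_mes m (\<lambda>j. \<phi> j - u) h = sub_mes m \<phi> h"
proof -
  have "(+) u ` (sublevel m (\<lambda>j. \<phi> j - u) h \<inter> {0..<2*pi}) = sublevel m \<phi> h \<inter> {u..<u+2*pi}"
    by (auto simp: sublevel_def sine_prod_minus add.commute intro!: image_eqI[of _ _ "t - u" for t])
  then show ?thesis
    unfolding sub_mes_window[of m \<phi> h u] by (metis sub_mes_def measure_translation)
qed

lemma sub_mes_cong:
  assumes "\<And>j. j < m \<Longrightarrow> cis (\<phi> j) = cis (\<psi> j)"
  shows "sub_mes m \<phi> h = sub_mes m \<psi> h"
  unfolding sub_mes_def sublevel_def using sine_prod_abs_cong[OF assms] by simp

lemma sub_mes_le: "sub_mes m \<phi> h \<le> 2 * pi"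
proof -
  have "sub_mes m \<phi> h \<le> measure lebesgue {0..<2*pi}"
    unfolding sub_mes_def by (rule measure_mono_fmeasurable) (auto intro!: bounded_set_imp_lmeasurable)
  then show ?thesis by simp
qed

lemma sub_mes_nonneg: "0 \<le> sub_mes m \<phi> h"
  by (simp add: sub_mes_def)

section \<open>Transport of roots\<close>

lemma root_poly_degree: "degree (root_poly m \<phi>) = m"
  unfolding root_poly_def by (subst degree_prod_sum_eq) auto

lemma root_poly_lead: "coeff (root_poly m \<phi>) m = 1"
proof -
  have "lead_coeff (root_poly m \<phi>) = 1"
    unfolding root_poly_def lead_coeff_prod by simp
  then show ?thesis
    by (simp add: root_poly_degree)
qed

text \<open>With \<open>a = P(0)\<close>, of modulus 1, the points \<open>cis (x k)\<close> are the
  solutions of \<open>z ^ m = a\<close>. Averaging \<open>P\<close> over them kills every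
  coefficient except the constant and the leading one, and each of these two contributes
  \<open>a\<close>. The mean has modulus 2, so some value has modulus at least 2.\<close>

lemma exists_sine_prod_ge_2:
  assumes "m \<ge> 1"
  shows "\<exists>t. \<bar>sine_prod m \<phi> t\<bar> \<ge> 2"
proof (rule ccontr)
  assume "\<not> ?thesis"
  then have small: "\<bar>sine_prod m \<phi> t\<bar> < 2" for t
    by (meson not_le)
  define P where "P = root_poly m \<phi>"
  define a where "a = coeff P 0"
  have "a = poly P 0"
    by (simp add: a_def poly_0_coeff_0)
  then have "cmod a = 1"
    by (simp add: P_def poly_root_poly prod_norm[symmetric])
  then have a: "a = cis (Arg a)"
    by (metis cis_Arg div_by_1 norm_eq_zero of_real_1 sgn_eq zero_neq_one)
  define x where "x k = (Arg a + 2 * pi * real k) / real m" for k :: nat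
  have filter: "(\<Sum>k<m. cis (x k) ^ l) = (if l = 0 then of_nat m else if l = m then of_nat m * a else 0)"
    if lm: "l \<le> m" for l
  proof -
    define q where "q = cis (2 * pi * real l / real m)"
    have pw: "cis (x k) ^ l = cis (real l * Arg a / real m) * q ^ k" for k
      unfolding q_def Complex.DeMoivre x_def cis_mult
      by (rule arg_cong[of _ _ cis]) (simp add: add_divide_distrib distrib_left mult.commute mult.left_commute)
    have sum: "(\<Sum>k<m. cis (x k) ^ l) = cis (real l * Arg a / real m) * (\<Sum>k<m. q ^ k)"
      by (simp add: pw sum_distrib_left)
    consider "l = 0" | "l = m" | "0 < l" "l < m"
      using lm by linarith
    then show ?thesis
    proof cases
      case 1
      then show ?thesis by simp
    next
      case 2
      have "q = 1"
        using 2 assms by (simp add: q_def)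
      then show ?thesis
        using sum 2 assms a by simp
    next
      case 3
      have "q \<noteq> 1"
      proof
        assume "q = 1"
        then have "cos (2 * pi * real l / real m) = 1"
          by (simp add: q_def complex_eq_iff)
        then obtain n :: int where "2 * pi * real l / real m = of_int n * 2 * pi"
          by (auto simp: cos_one_2pi_int)
        then have "real l = of_int n * real m"
          using assms by (simp add: field_simps)
        then have "int l = n * int m"
          by (metis of_int_eq_iff of_int_mult of_int_of_nat_eq)
        then show False
          using 3 by (metis dvd_triv_right int_dvd_int_iff nat_dvd_not_less)
      qed
      moreover have "q ^ m = 1"
        using assms by (simp add: q_def Complex.DeMoivre)
      ultimately have "(\<Sum>k<m. q ^ k) = 0"
        by (simp add: sum_gp_strict)
      then show ?thesis
        using sum 3 by simp
    qed
  qed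
  have "(\<Sum>k<m. poly P (cis (x k))) = (\<Sum>k<m. \<Sum>l\<le>m. coeff P l * cis (x k) ^ l)"
    by (simp add: poly_altdef P_def root_poly_degree)
  also have "\<dots> = (\<Sum>l\<le>m. coeff P l * (\<Sum>k<m. cis (x k) ^ l))"
    by (subst sum.swap) (simp add: sum_distrib_left)
  also have "\<dots> = (\<Sum>l\<le>m. if l = 0 then a * of_nat m else if l = m then of_nat m * a else 0)"
    by (rule sum.cong) (auto simp: filter a_def P_def root_poly_lead)
  also have "\<dots> = (\<Sum>l\<in>{0, m}. if l = 0 then a * of_nat m else if l = m then of_nat m * a else 0)"
    by (rule sum.mono_neutral_right) auto
  also have "\<dots> = 2 * of_nat m * a"
    using assms by simp
  finally have "cmod (\<Sum>k<m. poly P (cis (x k))) = 2 * real m"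
    using \<open>cmod a = 1\<close> by (simp add: norm_mult)
  moreover have "cmod (\<Sum>k<m. poly P (cis (x k))) \<le> (\<Sum>k<m. \<bar>sine_prod m \<phi> (x k)\<bar>)"
    by (rule order_trans[OF norm_sum]) (simp add: P_def cmod_root_poly_cis)
  moreover have "(\<Sum>k<m. \<bar>sine_prod m \<phi> (x k)\<bar>) < (\<Sum>k<m. 2)"
    using assms small by (intro sum_strict_mono) (auto simp: lessThan_empty_iff)
  ultimately show False by simp
qed

lemma exists_max_sine_prod:
  "\<exists>u. \<forall>t. \<bar>sine_prod m \<phi> t\<bar> \<le> \<bar>sine_prod m \<phi> u\<bar>"
proof -
  have "\<exists>u\<in>{0..2*pi}. \<forall>t\<in>{0..2*pi}. \<bar>sine_prod m \<phi> t\<bar> \<le> \<bar>sine_prod m \<phi> u\<bar>"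
    by (rule continuous_attains_sup) (auto intro!: continuous_intros)
  then obtain u where u: "\<And>t. t \<in> {0..2*pi} \<Longrightarrow> \<bar>sine_prod m \<phi> t\<bar> \<le> \<bar>sine_prod m \<phi> u\<bar>"
    by blast
  have "\<bar>sine_prod m \<phi> t\<bar> \<le> \<bar>sine_prod m \<phi> u\<bar>" for t
  proof -
    define k where "k = \<lfloor>t / (2 * pi)\<rfloor>"
    have "of_int k \<le> t / (2 * pi)" "t / (2 * pi) < of_int k + 1"
      by (auto simp: k_def)
    then have "t + 2 * pi * of_int (- k) \<in> {0..2*pi}"
      by (auto simp: field_simps)
    then show ?thesis
      using u sine_prod_periodic_int by metis
  qed
  then show ?thesis by blast
qed

lemma sine_prod_eq_0_iff: "sine_prod m \<phi> t = 0 \<longleftrightarrow> (\<exists>j<m. sin ((t - \<phi> j) / 2) = 0)"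
  by (auto simp: sine_prod_def)

text \<open>The logarithmic derivative vanishes at the maximum. The roots enter as
  \<open>\<phi> j - u\<close>, their positions after \<open>u\<close> is rotated to 0, where the
  flow has its pole.\<close>

lemma sum_cot_eq_0_at_max:
  assumes max: "\<And>t. \<bar>sine_prod m \<phi> t\<bar> \<le> \<bar>sine_prod m \<phi> u\<bar>" and nz: "sine_prod m \<phi> u \<noteq> 0"
  shows "(\<Sum>j<m. cot ((\<phi> j - u) / 2)) = 0"
proof -
  have s: "sin ((u - \<phi> j) / 2) \<noteq> 0" if "j < m" for j
    using nz that by (auto simp: sine_prod_eq_0_iff)
  have "((\<lambda>t. \<Prod>j<m. 2 * sin ((t - \<phi> j) / 2)) has_field_derivative
      (\<Prod>j<m. 2 * sin ((u - \<phi> j) / 2)) * (\<Sum>j<m. cos ((u - \<phi> j) / 2) / (2 * sin ((u - \<phi> j) / 2)))) (at u)"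
    by (rule has_field_derivative_prod') (use s in \<open>auto intro!: derivative_eq_intros\<close>)
  then have D: "(sine_prod m \<phi> has_field_derivative
      sine_prod m \<phi> u * (\<Sum>j<m. cos ((u - \<phi> j) / 2) / (2 * sin ((u - \<phi> j) / 2)))) (at u)"
    by (simp add: sine_prod_def[abs_def])
  \<comment> \<open>The square has a maximum at \<open>u\<close> whatever the sign of the product
    there.\<close>
  have D2: "((\<lambda>t. (sine_prod m \<phi> t)\<^sup>2) has_field_derivative
      2 * sine_prod m \<phi> u * (sine_prod m \<phi> u * (\<Sum>j<m. cos ((u - \<phi> j) / 2) / (2 * sin ((u - \<phi> j) / 2))))) (at u)"
    by (auto intro!: derivative_eq_intros D)
  have "2 * sine_prod m \<phi> u * (sine_prod m \<phi> u * (\<Sum>j<m. cos ((u - \<phi> j) / 2) / (2 * sin ((u - \<phi> j) / 2)))) = 0"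
    by (rule DERIV_local_max[OF D2, of 1]) (use max in \<open>auto simp: abs_le_square_iff\<close>)
  then have "(\<Sum>j<m. cos ((u - \<phi> j) / 2) / (2 * sin ((u - \<phi> j) / 2))) = 0"
    using nz by simp
  moreover have "cos ((u - \<phi> j) / 2) / (2 * sin ((u - \<phi> j) / 2)) = - cot ((\<phi> j - u) / 2) / 2" for j
  proof -
    have "(u - \<phi> j) / 2 = - ((\<phi> j - u) / 2)" by (simp add: minus_divide_left)
    then have "cos ((u - \<phi> j) / 2) = cos ((\<phi> j - u) / 2)" "sin ((u - \<phi> j) / 2) = - sin ((\<phi> j - u) / 2)"
      by (metis cos_minus, metis sin_minus)
    then show ?thesis
      by (simp add: cot_def)
  qed
  ultimately show ?thesis
    by (simp add: sum_divide_distrib[symmetric] sum_negf)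
qed

section \<open>Effect of the flow on the product\<close>

lemma abs_sin_minus_le: "\<bar>sin w - w\<bar> \<le> (w::real)\<^sup>2 / 2"
  using Maclaurin_sin_bound[of w 2]
  by (simp add: numeral_2_eq_2 sin_coeff_def field_simps)

lemma one_minus_cos_le: "1 - cos w \<le> (w::real)\<^sup>2 / 2" "0 \<le> 1 - cos w"
proof -
  have "1 - cos w = 2 * (sin (w / 2))\<^sup>2"
    using cos_double_sin[of "w / 2"] by simp
  moreover have "(sin (w / 2))\<^sup>2 \<le> (w / 2)\<^sup>2"
    using abs_sin_x_le_abs_x[of "w / 2"] by (simp only: abs_le_square_iff)
  ultimately show "1 - cos w \<le> w\<^sup>2 / 2"
    by (simp add: power_divide)
qed simp

text \<open>The flow changes the half difference of \<open>x\<close> and \<open>\<phi>\<close> by a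
  multiple of its own sine \<open>s\<close>. The error is therefore bounded relative to
  \<open>|s|\<close>, and the estimate holds up to and including the zeros of the factor.\<close>

lemma abs_sin_transport_le:
  fixes x \<phi> e M :: real
  assumes sx: "sin (x / 2) \<noteq> 0" and sp: "sin (\<phi> / 2) \<noteq> 0" and e: "0 \<le> e"
    and M: "1 / \<bar>sin (x / 2) * sin (\<phi> / 2)\<bar> \<le> M"
  shows "\<bar>sin ((x - e * cot (x / 2) - (\<phi> - e * cot (\<phi> / 2))) / 2)\<bar>
    \<le> \<bar>sin ((x - \<phi>) / 2)\<bar> * exp (e / 2 * (1 + cot (x / 2) * cot (\<phi> / 2)) + e\<^sup>2 * M\<^sup>2)"
proof -
  define a b s c where "a = sin (x / 2)" and "b = sin (\<phi> / 2)"
    and "s = sin ((x - \<phi>) / 2)" and "c = cos ((x - \<phi>) / 2)"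
  define w where "w = - e * s / (2 * a * b)"
  define y where "y = e / 2 * (c / (a * b))"
  have ab: "a \<noteq> 0" "b \<noteq> 0" using sx sp by (auto simp: a_def b_def)
  have half: "(x - \<phi>) / 2 = x / 2 - \<phi> / 2" by simp
  have s: "s = a * cos (\<phi> / 2) - cos (x / 2) * b"
    unfolding s_def half sin_diff a_def b_def by simp
  have c: "c = cos (x / 2) * cos (\<phi> / 2) + a * b"
    unfolding c_def half cos_diff a_def b_def by simp
  have d: "cot (x / 2) - cot (\<phi> / 2) = - s / (a * b)"
    using ab unfolding s cot_def a_def[symmetric] b_def[symmetric] by (simp add: field_simps)
  have g: "1 + cot (x / 2) * cot (\<phi> / 2) = c / (a * b)"
    using ab unfolding c cot_def a_def[symmetric] b_def[symmetric] by (simp add: field_simps)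
  have arg: "(x - e * cot (x / 2) - (\<phi> - e * cot (\<phi> / 2))) / 2 = (x - \<phi>) / 2 - w"
  proof -
    have "(x - e * cot (x / 2) - (\<phi> - e * cot (\<phi> / 2))) / 2 = (x - \<phi>) / 2 - e / 2 * (cot (x / 2) - cot (\<phi> / 2))"
      by (simp add: field_simps)
    then show ?thesis
      by (simp add: d w_def)
  qed
  have M': "\<bar>1 / (a * b)\<bar> \<le> M"
    using M by (simp add: a_def b_def abs_mult)
  have s1: "\<bar>s\<bar> \<le> 1" and c1: "\<bar>c\<bar> \<le> 1"
    by (auto simp: s_def c_def)
  have w_le: "\<bar>w\<bar> \<le> e * M * \<bar>s\<bar> / 2"
  proof -
    have "\<bar>w\<bar> = e / 2 * (\<bar>s\<bar> * \<bar>1 / (a * b)\<bar>)"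
      using e by (simp add: w_def abs_mult)
    also have "\<dots> \<le> e / 2 * (\<bar>s\<bar> * M)"
      using e M' by (intro mult_left_mono) auto
    finally show ?thesis by (simp add: algebra_simps)
  qed
  have y_le: "\<bar>y\<bar> \<le> e * M / 2"
  proof -
    have "\<bar>y\<bar> = e / 2 * (\<bar>c\<bar> * \<bar>1 / (a * b)\<bar>)"
      using e by (simp add: y_def abs_mult)
    also have "\<dots> \<le> e / 2 * (1 * M)"
      using e M' c1 by (intro mult_left_mono mult_mono) auto
    finally show ?thesis by simp
  qed
  have M0: "0 \<le> M" using M' by (meson abs_ge_zero order_trans)
  \<comment> \<open>One factor \<open>|s|\<close> is kept and the other is bounded by 1, so that the
    quadratic error is still a multiple of \<open>|s|\<close>.\<close>
  have "w\<^sup>2 \<le> (e * M * \<bar>s\<bar> / 2)\<^sup>2"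
    using w_le by (metis abs_ge_zero power2_abs power_mono)
  also have "\<dots> = \<bar>s\<bar> * (\<bar>s\<bar> * (e\<^sup>2 * M\<^sup>2 / 4))"
    by (simp add: power2_eq_square)
  also have "\<dots> \<le> \<bar>s\<bar> * (1 * (e\<^sup>2 * M\<^sup>2 / 4))"
    using s1 by (intro mult_left_mono mult_right_mono) auto
  finally have w2: "w\<^sup>2 \<le> \<bar>s\<bar> * (e\<^sup>2 * M\<^sup>2 / 4)" by simp
  also have "\<dots> \<le> 1 * (e\<^sup>2 * M\<^sup>2 / 4)"
    using s1 by (intro mult_right_mono) auto
  finally have w2': "w\<^sup>2 \<le> e\<^sup>2 * M\<^sup>2 / 4" by simp
  have y2: "y\<^sup>2 \<le> e\<^sup>2 * M\<^sup>2 / 4"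
    using power_mono[OF y_le, of 2] by (simp add: power_mult_distrib power_divide)
  \<comment> \<open>To first order the new sine is \<open>s - c * w\<close>, which this identity
    turns into \<open>s * (1 + y)\<close>.\<close>
  have "c * w = - (s * y)"
    by (simp add: w_def y_def mult.commute mult.left_commute)
  then have "s * cos w - c * sin w = s * (1 + y) - s * (1 - cos w) - c * (sin w - w)"
    by (simp add: algebra_simps)
  also have "\<bar>\<dots>\<bar> \<le> \<bar>s * (1 + y)\<bar> + \<bar>s * (1 - cos w)\<bar> + \<bar>c * (sin w - w)\<bar>"
    by linarith
  also have "\<dots> \<le> \<bar>s\<bar> * (1 + y + y\<^sup>2) + \<bar>s\<bar> * (w\<^sup>2 / 2) + w\<^sup>2 / 2"
  proof (intro add_mono)
    \<comment> \<open>The bound on \<open>|1 + y|\<close> derived from this holds for every real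
      \<open>y\<close>, also when \<open>1 + y\<close> is negative.\<close>
    have "0 \<le> (y + 1)\<^sup>2 + 1" by simp
    then have "\<bar>1 + y\<bar> \<le> 1 + y + y\<^sup>2"
      by (simp add: abs_le_iff power2_eq_square algebra_simps)
    then show "\<bar>s * (1 + y)\<bar> \<le> \<bar>s\<bar> * (1 + y + y\<^sup>2)"
      by (simp add: abs_mult mult_left_mono)
    show "\<bar>s * (1 - cos w)\<bar> \<le> \<bar>s\<bar> * (w\<^sup>2 / 2)"
      unfolding abs_mult using one_minus_cos_le[of w] by (intro mult_left_mono) linarith+
    have "\<bar>c * (sin w - w)\<bar> \<le> 1 * (w\<^sup>2 / 2)"
      unfolding abs_mult by (intro mult_mono abs_sin_minus_le c1) auto
    then show "\<bar>c * (sin w - w)\<bar> \<le> w\<^sup>2 / 2" by simp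
  qed
  also have "\<dots> \<le> \<bar>s\<bar> * (1 + y + e\<^sup>2 * M\<^sup>2 / 4) + \<bar>s\<bar> * (e\<^sup>2 * M\<^sup>2 / 8) + \<bar>s\<bar> * (e\<^sup>2 * M\<^sup>2 / 8)"
    using w2 w2' y2 by (intro add_mono mult_left_mono) auto
  also have "\<dots> = \<bar>s\<bar> * (1 + (y + e\<^sup>2 * M\<^sup>2 / 2))"
    by (simp add: algebra_simps)
  also have "\<dots> \<le> \<bar>s\<bar> * exp (y + e\<^sup>2 * M\<^sup>2)"
  proof (intro mult_left_mono)
    have "1 + (y + e\<^sup>2 * M\<^sup>2 / 2) \<le> 1 + (y + e\<^sup>2 * M\<^sup>2)" by simp
    also have "\<dots> \<le> exp (y + e\<^sup>2 * M\<^sup>2)" by (rule exp_ge_add_one_self)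
    finally show "1 + (y + e\<^sup>2 * M\<^sup>2 / 2) \<le> exp (y + e\<^sup>2 * M\<^sup>2)" .
  qed simp
  finally show ?thesis
    unfolding arg g sin_diff s_def[symmetric] c_def[symmetric] y_def[symmetric] .
qed

text \<open>Multiplying the estimates for single factors adds the exponents. By \<open>crit\<close>
  the terms with \<open>cot (x / 2)\<close> cancel, so the first-order growth rate
  \<open>m / 2\<close> is the same at every \<open>x\<close>; the bound \<open>r\<close> makes
  \<open>C\<close> uniform in \<open>x\<close>.\<close>

lemma sine_prod_transport:
  assumes s: "\<And>j. j < m \<Longrightarrow> sin (\<phi> j / 2) \<noteq> 0" and crit: "(\<Sum>j<m. cot (\<phi> j / 2)) = 0" and "0 < r"
  shows "\<exists>C\<ge>0. \<forall>x e::real. 0 \<le> e \<longrightarrow> r \<le> \<bar>sin (x / 2)\<bar> \<longrightarrow>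
      \<bar>sine_prod m (\<lambda>j. \<phi> j - e * cot (\<phi> j / 2)) (x - e * cot (x / 2))\<bar>
        \<le> \<bar>sine_prod m \<phi> x\<bar> * exp (real m * e / 2 + C * e\<^sup>2)"
proof -
  define M where "M = (\<Sum>j<m. 1 / (r * \<bar>sin (\<phi> j / 2)\<bar>))"
  have M: "1 / (r * \<bar>sin (\<phi> j / 2)\<bar>) \<le> M" if "j < m" for j
    unfolding M_def using that \<open>0 < r\<close> by (intro member_le_sum) auto
  show ?thesis
  proof (intro exI[of _ "m * M\<^sup>2"] conjI allI impI)
    fix x e :: real
    assume e: "0 \<le> e" and x: "r \<le> \<bar>sin (x / 2)\<bar>"
    have "\<bar>sine_prod m (\<lambda>j. \<phi> j - e * cot (\<phi> j / 2)) (x - e * cot (x / 2))\<bar>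
      = (\<Prod>j<m. 2 * \<bar>sin ((x - e * cot (x / 2) - (\<phi> j - e * cot (\<phi> j / 2))) / 2)\<bar>)"
      by (simp add: sine_prod_def abs_prod abs_mult)
    also have "\<dots> \<le> (\<Prod>j<m. 2 * (\<bar>sin ((x - \<phi> j) / 2)\<bar> * exp (e / 2 * (1 + cot (x / 2) * cot (\<phi> j / 2)) + e\<^sup>2 * M\<^sup>2)))"
    proof (intro prod_mono conjI mult_left_mono abs_sin_transport_le)
      fix j assume "j \<in> {..<m}"
      then have "sin (\<phi> j / 2) \<noteq> 0" "1 / (r * \<bar>sin (\<phi> j / 2)\<bar>) \<le> M"
        using s M by auto
      moreover have "1 / \<bar>sin (x / 2) * sin (\<phi> j / 2)\<bar> \<le> 1 / (r * \<bar>sin (\<phi> j / 2)\<bar>)"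
        unfolding abs_mult using x \<open>0 < r\<close> \<open>sin (\<phi> j / 2) \<noteq> 0\<close>
        by (intro divide_left_mono mult_right_mono) auto
      ultimately show "1 / \<bar>sin (x / 2) * sin (\<phi> j / 2)\<bar> \<le> M"
        by simp
    qed (use s x \<open>0 < r\<close> e in auto)
    also have "\<dots> = (\<Prod>j<m. \<bar>2 * sin ((x - \<phi> j) / 2)\<bar>) * (\<Prod>j<m. exp (e / 2 * (1 + cot (x / 2) * cot (\<phi> j / 2)) + e\<^sup>2 * M\<^sup>2))"
      unfolding prod.distrib[symmetric] by (rule prod.cong) (auto simp: abs_mult)
    also have "(\<Prod>j<m. exp (e / 2 * (1 + cot (x / 2) * cot (\<phi> j / 2)) + e\<^sup>2 * M\<^sup>2))
      = exp (\<Sum>j<m. e / 2 * (1 + cot (x / 2) * cot (\<phi> j / 2)) + e\<^sup>2 * M\<^sup>2)"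
      by (simp add: exp_sum)
    also have "(\<Sum>j<m. e / 2 * (1 + cot (x / 2) * cot (\<phi> j / 2)) + e\<^sup>2 * M\<^sup>2)
      = e / 2 * (m + cot (x / 2) * (\<Sum>j<m. cot (\<phi> j / 2))) + m * (e\<^sup>2 * M\<^sup>2)"
      by (simp add: sum.distrib sum_distrib_left algebra_simps)
    also have "\<dots> = m * e / 2 + m * M\<^sup>2 * e\<^sup>2"
      by (simp add: crit)
    finally show "\<bar>sine_prod m (\<lambda>j. \<phi> j - e * cot (\<phi> j / 2)) (x - e * cot (x / 2))\<bar>
        \<le> \<bar>sine_prod m \<phi> x\<bar> * exp (real m * e / 2 + m * M\<^sup>2 * e\<^sup>2)"
      by (simp add: sine_prod_def abs_prod)
  qed simp
qed

section \<open>Measure of a flowed set\<close>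

lemma cot_half_diff:
  assumes "sin (x / 2) \<noteq> 0" "sin (y / 2) \<noteq> 0"
  shows "cot (x / 2) - cot (y / 2) = sin ((y - x) / 2) / (sin (x / 2) * sin (y / 2) :: real)"
proof -
  have "sin ((y - x) / 2) = sin (y / 2) * cos (x / 2) - cos (y / 2) * sin (x / 2)"
    unfolding sin_diff[symmetric] by (simp add: diff_divide_distrib)
  then show ?thesis
    using assms by (simp add: cot_def field_simps)
qed

lemma flow_strict_mono:
  assumes "0 < x" "x < y" "y < 2 * pi" "0 \<le> e"
  shows "x - e * cot (x / 2) < y - e * cot (y / 2)"
proof -
  have "0 < sin (x / 2)" "0 < sin (y / 2)" "0 < sin ((y - x) / 2)"
    using assms by (auto intro!: sin_gt_zero)
  then have "0 \<le> cot (x / 2) - cot (y / 2)"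
    by (simp add: cot_half_diff)
  then have "0 \<le> e * (cot (x / 2) - cot (y / 2))"
    using assms by simp
  then show ?thesis
    using assms by (simp add: right_diff_distrib)
qed

lemma has_field_derivative_cot_half:
  assumes "sin (x / 2) \<noteq> (0::real)"
  shows "((\<lambda>x. cot (x / 2)) has_field_derivative - (1 / (2 * (sin (x / 2))\<^sup>2))) (at x within S)"
proof -
  have "((\<lambda>x::real. x / 2) has_field_derivative 1 / 2) (at x within S)"
    by (auto intro!: derivative_eq_intros)
  note DERIV_chain2[OF DERIV_cot[OF assms] this]
  moreover have "- inverse ((sin (x / 2))\<^sup>2) * (1 / 2) = - (1 / (2 * (sin (x / 2))\<^sup>2))"
    by (simp add: inverse_eq_divide)
  ultimately show ?thesis
    by (simp only:)
qed

text \<open>Change of variables: the flow is injective on \<open>S\<close> with derivative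
  \<open>1 + e * w\<close>, \<open>w\<close> being the weight in the integral, so the measure of the
  image is exactly affine in \<open>e\<close>. The bound \<open>r\<close> keeps \<open>S\<close>
  away from the pole and the weight bounded.\<close>

lemma measure_flow_image:
  assumes S: "S \<in> sets lebesgue" "S \<subseteq> {0<..<2*pi}" and r: "0 < r" "\<And>x. x \<in> S \<Longrightarrow> r \<le> sin (x / 2)"
    and e: "0 \<le> e"
  shows "(\<lambda>x. 1 / (2 * (sin (x / 2))\<^sup>2)) absolutely_integrable_on S"
    and "(\<lambda>x. x - e * cot (x / 2)) ` S \<in> lmeasurable"
    and "measure lebesgue ((\<lambda>x. x - e * cot (x / 2)) ` S)
      = measure lebesgue S + e * integral S (\<lambda>x. 1 / (2 * (sin (x / 2))\<^sup>2))"
proof -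
  let ?X = "\<lambda>x. x - e * cot (x / 2)"
  define w where "w = (\<lambda>x::real. 1 / (2 * (sin (x / 2))\<^sup>2))"
  have lm: "S \<in> lmeasurable"
    using S by (intro bounded_set_imp_lmeasurable bounded_subset[OF bounded_closed_interval[of 0 "2*pi"]]) force+
  have bound: "norm (w x) \<le> 1 / (2 * r\<^sup>2)" if "x \<in> S" for x
  proof -
    have "r\<^sup>2 \<le> (sin (x / 2))\<^sup>2"
      using r that by (intro power_mono) auto
    moreover have "0 < sin (x / 2)" using r that by force
    ultimately show ?thesis
      using r(1) by (simp add: w_def) (simp add: field_simps)
  qed
  have meas: "w \<in> borel_measurable (lebesgue_on S)"
    unfolding w_def by (intro measurable_restrict_space1 measurable_completion) measurable
  show wi: "(\<lambda>x. 1 / (2 * (sin (x / 2))\<^sup>2)) absolutely_integrable_on S"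
    unfolding w_def[symmetric]
    by (rule measurable_bounded_by_integrable_imp_absolutely_integrable[OF meas S(1) _ bound])
       (rule integrable_on_const[OF lm])
  have one: "(\<lambda>x. 1::real) absolutely_integrable_on S"
    using lm by (simp add: absolutely_integrable_on_const)
  have inj: "inj_on ?X S"
  proof (rule linorder_inj_onI)
    fix x y assume "x < y" "x \<in> S" "y \<in> S"
    then show "?X x \<noteq> ?X y"
      using flow_strict_mono[of x y e] S e by force
  qed auto
  have der: "(?X has_field_derivative 1 + e * w x) (at x within S)" if "x \<in> S" for x
  proof -
    have "sin (x / 2) \<noteq> 0" using r that by force
    from DERIV_diff[OF DERIV_ident DERIV_cmult[OF has_field_derivative_cot_half[OF this]]]
    show ?thesis by (simp add: w_def)
  qed
  have pos: "\<bar>1 + e * w x\<bar> = 1 + e * w x" for x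
    using e by (simp add: w_def)
  have wi': "w absolutely_integrable_on S"
    using wi by (simp add: w_def)
  have ai: "(\<lambda>x. \<bar>1 + e * w x\<bar> * 1) absolutely_integrable_on S"
    unfolding pos using set_integral_add(1)[OF one set_integrable_mult_right[of e lebesgue S w]] wi' by simp
  have "integral S (\<lambda>x. \<bar>1 + e * w x\<bar> * 1) = measure lebesgue S + e * integral S w"
  proof -
    have "integral S (\<lambda>x. 1 + e * w x) = integral S (\<lambda>x. 1) + integral S (\<lambda>x. e * w x)"
      using one wi' by (intro integral_add integrable_on_mult_right) (auto simp: absolutely_integrable_on_def)
    then show ?thesis
      by (simp add: pos lmeasure_integral[OF lm])
  qed
  then have *: "(\<lambda>x. 1::real) absolutely_integrable_on (?X ` S) \<and>
      integral (?X ` S) (\<lambda>x. 1) = measure lebesgue S + e * integral S w"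
    using has_absolute_integral_change_of_variables_1'[OF S(1) der inj, of "\<lambda>_. 1"] ai by blast
  then show lmX: "?X ` S \<in> lmeasurable"
    by (simp add: lmeasurable_iff_integrable_on absolutely_integrable_on_def)
  show "measure lebesgue (?X ` S) = measure lebesgue S + e * integral S (\<lambda>x. 1 / (2 * (sin (x / 2))\<^sup>2))"
    using * lmX by (simp add: lmeasure_integral w_def)
qed

lemma half_csc2_has_integral:
  assumes "0 < a" "a \<le> b" "b < 2 * pi"
  shows "((\<lambda>x. 1 / (2 * (sin (x / 2))\<^sup>2)) has_integral (cot (a / 2) - cot (b / 2))) {a..b}"
proof -
  have "((\<lambda>x. 1 / (2 * (sin (x / 2))\<^sup>2)) has_integral (- cot (b / 2) - (- cot (a / 2)))) {a..b}"
  proof (rule fundamental_theorem_of_calculus)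
    fix x assume "x \<in> {a..b}"
    then have "sin (x / 2) \<noteq> 0"
      using assms sin_gt_zero[of "x / 2"] by auto
    then show "((\<lambda>x. - cot (x / 2)) has_vector_derivative 1 / (2 * (sin (x / 2))\<^sup>2)) (at x within {a..b})"
      unfolding has_real_derivative_iff_has_vector_derivative[symmetric]
      using DERIV_minus[OF has_field_derivative_cot_half] by simp
  qed fact
  then show ?thesis by simp
qed

lemma sin_half_ge:
  assumes "0 \<le> d" "d \<le> pi" "d \<le> x" "x \<le> 2 * pi - d"
  shows "sin (d / 2) \<le> sin (x / 2)"
proof (cases "x \<le> pi")
  case True
  then show ?thesis
    using assms by (intro sin_monotone_2pi_le) auto
next
  case False
  have "sin (d / 2) \<le> sin (pi - x / 2)"
    using assms False by (intro sin_monotone_2pi_le) auto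
  then show ?thesis by simp
qed

lemma sin_half_gt:
  assumes "0 \<le> d" "d < x" "x < 2 * pi - d"
  shows "sin (d / 2) < sin (x / 2)"
proof (cases "x \<le> pi")
  case True
  then show ?thesis
    using assms by (intro sin_monotone_2pi) auto
next
  case False
  have "sin (d / 2) < sin (pi - x / 2)"
    using assms False by (intro sin_monotone_2pi) auto
  then show ?thesis by simp
qed

lemma half_inverse_square_mono:
  assumes "0 < (a::real)"
  shows "a \<le> b \<Longrightarrow> 1 / (2 * b\<^sup>2) \<le> 1 / (2 * a\<^sup>2)" and "a < b \<Longrightarrow> 1 / (2 * b\<^sup>2) < 1 / (2 * a\<^sup>2)"
proof -
  show "1 / (2 * b\<^sup>2) \<le> 1 / (2 * a\<^sup>2)" if "a \<le> b"
  proof -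
    have "a\<^sup>2 \<le> b\<^sup>2" using that assms by (intro power_mono) auto
    then show ?thesis using that assms by (simp add: field_simps)
  qed
  show "1 / (2 * b\<^sup>2) < 1 / (2 * a\<^sup>2)" if "a < b"
  proof -
    have "a\<^sup>2 < b\<^sup>2" using that assms by (intro power_strict_mono) auto
    then show ?thesis using that assms by (simp add: field_simps)
  qed
qed

text \<open>Bathtub principle: the weight increases with the distance from \<open>\<pi>\<close>, so among sets of given
  measure its integral is least on the arc centred at \<open>\<pi>\<close>.\<close>

lemma integral_half_csc2_ge:
  assumes S: "S \<in> sets lebesgue" "S \<subseteq> {0<..<2*pi}" and r: "0 < r" "\<And>x. x \<in> S \<Longrightarrow> r \<le> sin (x / 2)"
    and b: "measure lebesgue S = b" "b < 2 * pi"
  defines "W \<equiv> integral S (\<lambda>x. 1 / (2 * (sin (x / 2))\<^sup>2))"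
  shows "2 * tan (b / 4) \<le> W"
    and "\<lbrakk>c < d; {c..d} \<subseteq> {pi - b/2<..<pi + b/2}; {c..d} \<inter> S = {}\<rbrakk> \<Longrightarrow> 2 * tan (b / 4) < W"
proof -
  have b0: "0 \<le> b" using b by auto
  define w where "w = (\<lambda>x::real. 1 / (2 * (sin (x / 2))\<^sup>2))"
  define I where "I = {pi - b/2..pi + b/2}"
  \<comment> \<open>The value of the weight at the ends of the centred arc \<open>I\<close>, the
    threshold of the bathtub.\<close>
  define k where "k = w (pi - b/2)"
  have lm: "S \<in> lmeasurable"
    using S by (intro bounded_set_imp_lmeasurable bounded_subset[OF bounded_closed_interval[of 0 "2*pi"]]) force+
  have wS: "w integrable_on S"
    using measure_flow_image(1)[OF S r order_refl] by (auto simp: w_def absolutely_integrable_on_def)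
  have spos: "0 < sin ((pi - b/2) / 2)"
    using b b0 by (intro sin_gt_zero) auto
  have wI: "(w has_integral 2 * tan (b / 4)) I"
  proof -
    have 1: "(pi - b/2) / 2 = pi / 2 - b / 4" "(pi + b/2) / 2 = pi / 2 + b / 4"
      by (simp_all add: field_simps)
    have "cot ((pi - b/2) / 2) = tan (b / 4)"
      unfolding 1 by (simp add: cot_def tan_def cos_diff sin_diff)
    moreover have "cot ((pi + b/2) / 2) = - tan (b / 4)"
      unfolding 1 by (simp add: cot_def tan_def cos_add sin_add)
    ultimately show ?thesis
      unfolding I_def w_def using half_csc2_has_integral[of "pi - b/2" "pi + b/2"] b b0 by simp
  qed
  have "((\<lambda>x. w x - k) has_integral (W - k * b)) S"
  proof -
    have "((\<lambda>x. k) has_integral (k * b)) S"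
      using has_integral_mult_right[of "\<lambda>x. 1" b S k] lm b lmeasurable_iff_indicator_has_integral[of S] lmeasure_integral[OF lm]
      by (simp add: has_integral_iff lmeasurable_iff_integrable_on)
    then show ?thesis
      by (intro has_integral_diff) (use wS in \<open>simp_all add: W_def w_def[symmetric] has_integral_integral\<close>)
  qed
  then have 1: "((\<lambda>x. if x \<in> S then w x - k else 0) has_integral (W - k * b)) UNIV"
    by (simp add: has_integral_restrict_UNIV)
  have "((\<lambda>x. w x - k) has_integral (2 * tan (b / 4) - k * b)) I"
    using has_integral_const_real[of k "pi - b/2" "pi + b/2"] b0
    by (intro has_integral_diff wI) (simp add: I_def mult.commute)
  then have 2: "((\<lambda>x. if x \<in> I then w x - k else 0) has_integral (2 * tan (b / 4) - k * b)) UNIV"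
    by (simp add: has_integral_restrict_UNIV)
  \<comment> \<open>\<open>S\<close> and \<open>I\<close> both have measure \<open>b\<close>, so the
    constant \<open>k\<close> cancels in the integral of \<open>f\<close>. Since
    \<open>w \<le> k\<close> on \<open>I\<close> and \<open>w \<ge> k\<close> on \<open>S\<close>
    outside \<open>I\<close>, \<open>f\<close> is nonnegative.\<close>
  define f where "f = (\<lambda>x. (if x \<in> S then w x - k else 0) - (if x \<in> I then w x - k else 0))"
  have f: "(f has_integral (W - 2 * tan (b / 4))) UNIV"
    unfolding f_def using has_integral_diff[OF 1 2] by simp
  have w_le: "w x \<le> k" if "x \<in> I" for x
  proof -
    have "sin ((pi - b/2) / 2) \<le> sin (x / 2)"
      using that b b0 by (intro sin_half_ge) (auto simp: I_def)
    then show ?thesis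
      unfolding k_def w_def using spos by (intro half_inverse_square_mono)
  qed
  have w_less: "w x < k" if "x \<in> {pi - b/2<..<pi + b/2}" for x
  proof -
    have "sin ((pi - b/2) / 2) < sin (x / 2)"
      using that b b0 by (intro sin_half_gt) auto
    then show ?thesis
      unfolding k_def w_def using spos by (intro half_inverse_square_mono)
  qed
  have w_ge: "k \<le> w x" if "x \<in> S" "x \<notin> I" for x
  proof -
    have xpos: "0 < sin (x / 2)" using r that(1) by force
    have "sin (x / 2) \<le> sin ((pi - b/2) / 2)"
    proof (cases "x \<le> pi")
      case True
      then show ?thesis
        using that b b0 S(2) by (intro sin_half_ge) (auto simp: I_def)
    next
      case False
      have "sin ((2 * pi - x) / 2) \<le> sin ((pi - b/2) / 2)"
        using that b b0 S(2) False by (intro sin_half_ge) (auto simp: I_def)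
      moreover have "sin ((2 * pi - x) / 2) = sin (x / 2)"
        using sin_pi_minus[of "x / 2"] by (simp add: diff_divide_distrib)
      ultimately show ?thesis by simp
    qed
    then show ?thesis
      unfolding k_def w_def using xpos by (intro half_inverse_square_mono)
  qed
  have f0: "0 \<le> f x" for x
    using w_le[of x] w_ge[of x] by (auto simp: f_def)
  show "2 * tan (b / 4) \<le> W"
    using has_integral_nonneg[OF f] f0 by simp
  show "2 * tan (b / 4) < W" if cd: "c < d" "{c..d} \<subseteq> {pi - b/2<..<pi + b/2}" "{c..d} \<inter> S = {}"
  proof -
    have cont: "continuous_on {c..d} w"
    proof -
      have "sin (x / 2) \<noteq> 0" if "x \<in> {c..d}" for x
        using that cd(2) b b0 sin_gt_zero[of "x / 2"] by force
      then show ?thesis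
        unfolding w_def by (intro continuous_intros) auto
    qed
    obtain x where x: "x \<in> {c..d}" "\<And>y. y \<in> {c..d} \<Longrightarrow> w y \<le> w x"
      using continuous_attains_sup[OF _ _ cont] cd(1) by auto
    \<comment> \<open>\<open>{c..d}\<close> lies in the open arc, so even the largest value of
      \<open>w\<close> on it is below \<open>k\<close>. As \<open>{c..d}\<close> misses
      \<open>S\<close>, \<open>f\<close> equals \<open>k - w\<close> there, hence is at least
      \<open>q\<close>.\<close>
    define q where "q = k - w x"
    have q: "0 < q" using w_less x(1) cd(2) by (auto simp: q_def)
    have "((\<lambda>y. if y \<in> {c..d} then q else 0) has_integral ((d - c) * q)) UNIV"
      using has_integral_const_real[of q c d] cd(1) by (simp only: has_integral_restrict_UNIV) simp
    moreover have "(if y \<in> {c..d} then q else 0) \<le> f y" for y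
    proof (cases "y \<in> {c..d}")
      case True
      then have "y \<in> I" "y \<notin> S"
        using cd by (auto simp: I_def)
      then show ?thesis
        using True x(2)[OF True] by (simp add: f_def q_def)
    qed (use f0 in auto)
    ultimately have "(d - c) * q \<le> W - 2 * tan (b / 4)"
      using has_integral_le[OF _ f] by blast
    moreover have "0 < (d - c) * q" using q cd(1) by simp
    ultimately show ?thesis by linarith
  qed
qed

text \<open>One step of the radial Loewner flow centred at the point where \<open>\<bar>sine_prod m \<phi>\<bar>\<close> is largest.\<close>

lemma sub_mes_flow_step:
  assumes "m \<ge> 1" "h < 2"
  obtains u W C e0 where "0 \<le> C" "0 < e0" "sub_mes m \<phi> h < 2 * pi" "2 * tan (sub_mes m \<phi> h / 4) \<le> W"
    "W = 2 * tan (sub_mes m \<phi> h / 4) \<Longrightarrow>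
      {- sub_mes m \<phi> h / 2 <..< sub_mes m \<phi> h / 2} \<subseteq> sublevel m (\<lambda>j. \<phi> j - u) h"
    "\<And>e. 0 < e \<Longrightarrow> e < e0 \<Longrightarrow>
      \<exists>\<psi>. sub_mes m \<phi> h + e * W \<le> sub_mes m \<psi> (h * exp (real m * e / 2 + C * e\<^sup>2))"
proof -
  define b where "b = sub_mes m \<phi> h"
  obtain u where u: "\<And>t. \<bar>sine_prod m \<phi> t\<bar> \<le> \<bar>sine_prod m \<phi> u\<bar>"
    using exists_max_sine_prod by blast
  have u2: "2 \<le> \<bar>sine_prod m \<phi> u\<bar>"
    using exists_sine_prod_ge_2[OF \<open>m \<ge> 1\<close>, of \<phi>] u by (meson order_trans)
  define \<phi>0 where "\<phi>0 = (\<lambda>j. \<phi> j - u)"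
  have f0: "sine_prod m \<phi>0 t = sine_prod m \<phi> (t + u)" for t
    by (simp add: \<phi>0_def sine_prod_minus)
  have crit: "(\<Sum>j<m. cot (\<phi>0 j / 2)) = 0"
    unfolding \<phi>0_def by (rule sum_cot_eq_0_at_max) (use u u2 in auto)
  have snz: "sin (\<phi>0 j / 2) \<noteq> 0" if "j < m" for j
  proof -
    have "sine_prod m \<phi>0 0 \<noteq> 0" using u2 by (auto simp: f0)
    then have "sin (- (\<phi>0 j / 2)) \<noteq> 0"
      using that by (auto simp: sine_prod_eq_0_iff)
    then show ?thesis by (metis neg_equal_0_iff_equal sin_minus)
  qed
  define S where "S = sublevel m \<phi>0 h \<inter> {0..<2*pi}"
  have bS: "measure lebesgue S = b"
    using sub_mes_rotate[of m \<phi> u h] by (simp add: S_def b_def \<phi>0_def sub_mes_def)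
  \<comment> \<open>The maximum, now at 0, has height at least 2 while \<open>h < 2\<close>; hence
    \<open>S\<close> keeps a distance \<open>d\<close> from the pole of the flow.\<close>
  obtain d where d: "0 < d" "d \<le> pi" "\<And>t. \<bar>t\<bar> < d \<Longrightarrow> h < \<bar>sine_prod m \<phi>0 t\<bar>"
  proof -
    have "open (- sublevel m \<phi>0 h)"
      by (intro open_Compl closed_sublevel)
    moreover have "0 \<in> - sublevel m \<phi>0 h"
      using u2 \<open>h < 2\<close> by (auto simp: sublevel_def f0)
    ultimately obtain d where "0 < d" "ball 0 d \<subseteq> - sublevel m \<phi>0 h"
      by (meson open_contains_ball)
    then show ?thesis
      by (intro that[of "min d pi"]) (auto simp: sublevel_def subset_iff not_le)
  qed
  have S_sub: "S \<subseteq> {d..2*pi-d}"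
  proof
    fix t assume t: "t \<in> S"
    have "d \<le> t"
      using d(3)[of t] t by (force simp: S_def sublevel_def)
    moreover have "t \<le> 2 * pi - d"
      using d(3)[of "t - 2 * pi"] t sine_prod_periodic[of m \<phi>0 "t - 2 * pi"] by (force simp: S_def sublevel_def)
    ultimately show "t \<in> {d..2*pi-d}" by simp
  qed
  define r where "r = sin (d / 2)"
  have r: "0 < r" using d by (auto simp: r_def intro!: sin_gt_zero)
  have r_le: "r \<le> sin (x / 2)" if "x \<in> S" for x
    unfolding r_def using that S_sub d by (intro sin_half_ge) auto
  have S_meas: "S \<in> sets lebesgue"
    by (simp add: S_def fmeasurableD)
  have S_in: "S \<subseteq> {0<..<2*pi}"
    using S_sub d(1) by force
  have b_less: "b < 2 * pi"
  proof -
    have "b \<le> measure lebesgue {d..2*pi-d}"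
      unfolding bS[symmetric] using S_sub S_meas by (intro measure_mono_fmeasurable) auto
    also have "\<dots> < 2 * pi" using d by auto
    finally show ?thesis .
  qed
  define W where "W = integral S (\<lambda>x. 1 / (2 * (sin (x / 2))\<^sup>2))"
  note bathtub = integral_half_csc2_ge[OF S_meas S_in r r_le bS b_less, folded W_def]
  have "\<exists>C\<ge>0. \<forall>x e::real. 0 \<le> e \<longrightarrow> r \<le> \<bar>sin (x / 2)\<bar> \<longrightarrow>
      \<bar>sine_prod m (\<lambda>j. \<phi>0 j - e * cot (\<phi>0 j / 2)) (x - e * cot (x / 2))\<bar>
        \<le> \<bar>sine_prod m \<phi>0 x\<bar> * exp (real m * e / 2 + C * e\<^sup>2)"
    by (rule sine_prod_transport) (use snz crit r in auto)
  then obtain C where C: "0 \<le> C" "\<forall>x e::real. 0 \<le> e \<longrightarrow> r \<le> \<bar>sin (x / 2)\<bar> \<longrightarrow>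
      \<bar>sine_prod m (\<lambda>j. \<phi>0 j - e * cot (\<phi>0 j / 2)) (x - e * cot (x / 2))\<bar>
        \<le> \<bar>sine_prod m \<phi>0 x\<bar> * exp (real m * e / 2 + C * e\<^sup>2)"
    by (elim exE conjE) (rule that)
  show thesis
  \<comment> \<open>Rotating by \<open>u\<close> puts the maximum at 0 and the bathtub arc around
    \<open>pi\<close>; rotating by \<open>u + pi\<close> centres this arc at 0. For
    \<open>e < r * d\<close> the flow moves points of \<open>S\<close> by less than
    \<open>d\<close>, so they stay in \<open>{0..<2*pi}\<close>.\<close>
  proof (rule that[of C "r * d" W "u + pi"])
    show "0 \<le> C" by fact
    show "0 < r * d" using r d by simp
    show "sub_mes m \<phi> h < 2 * pi" using b_less by (simp add: b_def)
    show "2 * tan (sub_mes m \<phi> h / 4) \<le> W" using bathtub(1) by (simp add: b_def)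
    show "{- sub_mes m \<phi> h / 2 <..< sub_mes m \<phi> h / 2} \<subseteq> sublevel m (\<lambda>j. \<phi> j - (u + pi)) h"
      if eq: "W = 2 * tan (sub_mes m \<phi> h / 4)"
    proof (rule subsetI, rule ccontr)
      fix t
      assume "t \<in> {- sub_mes m \<phi> h / 2 <..< sub_mes m \<phi> h / 2}" and
        t': "t \<notin> sublevel m (\<lambda>j. \<phi> j - (u + pi)) h"
      then have t: "- b / 2 < t" "t < b / 2"
        by (auto simp: b_def)
      from t' have "t + pi \<notin> sublevel m \<phi>0 h"
        by (simp add: sublevel_def f0 sine_prod_minus algebra_simps)
      then have "t + pi \<in> {pi - b/2<..<pi + b/2} \<inter> - sublevel m \<phi>0 h"
        using t by auto
      \<comment> \<open>The complement of the sublevel set is open, so one missed point brings a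
        whole missed interval, to which the strict bathtub inequality applies.\<close>
      moreover have "open ({pi - b/2<..<pi + b/2} \<inter> - sublevel m \<phi>0 h)"
        by (intro open_Int open_Compl closed_sublevel) auto
      ultimately obtain e where e: "0 < e" "cball (t + pi) e \<subseteq> {pi - b/2<..<pi + b/2} \<inter> - sublevel m \<phi>0 h"
        by (meson open_contains_cball)
      then have "2 * tan (b / 4) < W"
        by (intro bathtub(2)[of "t + pi - e" "t + pi + e"]) (auto simp: cball_eq_atLeastAtMost S_def)
      then show False using eq by (simp add: b_def)
    qed
    show "\<exists>\<psi>. sub_mes m \<phi> h + e * W \<le> sub_mes m \<psi> (h * exp (real m * e / 2 + C * e\<^sup>2))"
      if e: "0 < e" "e < r * d" for e
    proof -
      define \<psi> where "\<psi> = (\<lambda>j. \<phi>0 j - e * cot (\<phi>0 j / 2))"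
      have "(\<lambda>x. x - e * cot (x / 2)) ` S \<subseteq> sublevel m \<psi> (h * exp (real m * e / 2 + C * e\<^sup>2)) \<inter> {0..<2*pi}"
      proof safe
        fix x assume x: "x \<in> S"
        have "\<bar>sine_prod m \<psi> (x - e * cot (x / 2))\<bar> \<le> \<bar>sine_prod m \<phi>0 x\<bar> * exp (real m * e / 2 + C * e\<^sup>2)"
          unfolding \<psi>_def by (rule C(2)[rule_format]) (use e r_le[OF x] in auto)
        also have "\<dots> \<le> h * exp (real m * e / 2 + C * e\<^sup>2)"
          using x by (auto simp: S_def sublevel_def)
        finally show "x - e * cot (x / 2) \<in> sublevel m \<psi> (h * exp (real m * e / 2 + C * e\<^sup>2))"
          by (simp add: sublevel_def)
        have "\<bar>e * cot (x / 2)\<bar> \<le> e * (1 / r)"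
          unfolding abs_mult cot_def abs_divide using e r r_le[OF x] by (intro mult_mono frac_le) auto
        also have "\<dots> < d" using e r by (simp add: field_simps)
        finally have "\<bar>e * cot (x / 2)\<bar> < d" .
        then show "x - e * cot (x / 2) \<in> {0..<2*pi}"
          using S_sub x by force
      qed
      then have "measure lebesgue ((\<lambda>x. x - e * cot (x / 2)) ` S)
        \<le> sub_mes m \<psi> (h * exp (real m * e / 2 + C * e\<^sup>2))"
        unfolding sub_mes_def using measure_flow_image(2)[OF S_meas S_in r r_le] e
        by (intro measure_mono_fmeasurable) (auto simp: fmeasurableD)
      then show ?thesis
        using measure_flow_image(3)[OF S_meas S_in r r_le, of e] e by (auto simp: bS b_def W_def)
    qed
  qed
qed

section \<open>The sharp bound for sublevel sets\<close>

text \<open>A maximizing sequence has a convergent subsequence, along which the values still tend to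
  the supremum. Semicontinuity is thus only asked for along sequences whose values converge.\<close>

lemma usc_attains_sup:
  fixes f :: "'a::metric_space \<Rightarrow> real"
  assumes "compact K" "K \<noteq> {}" and bdd: "\<And>x. x \<in> K \<Longrightarrow> f x \<le> B"
    and usc: "\<And>X x l. (\<And>n. X n \<in> K) \<Longrightarrow> x \<in> K \<Longrightarrow> X \<longlonglongrightarrow> x \<Longrightarrow> (\<lambda>n. f (X n)) \<longlonglongrightarrow> l \<Longrightarrow> l \<le> f x"
  shows "\<exists>x\<in>K. \<forall>y\<in>K. f y \<le> f x"
proof -
  define S where "S = Sup (f ` K)"
  have b: "bdd_above (f ` K)" using bdd by (auto intro!: bdd_aboveI)
  have le: "f y \<le> S" if "y \<in> K" for y
    unfolding S_def using that b by (intro cSup_upper) auto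
  have "\<exists>x\<in>K. S - 1 / real (Suc n) < f x" for n
  proof -
    have "S - 1 / real (Suc n) < Sup (f ` K)" by (simp add: S_def)
    then show ?thesis
      using less_cSup_iff[OF _ b] assms(2) by auto
  qed
  then obtain X where X: "\<And>n. X n \<in> K" "\<And>n. S - 1 / real (Suc n) < f (X n)"
    by metis
  have lim: "(\<lambda>n. f (X n)) \<longlonglongrightarrow> S"
  proof (rule tendsto_sandwich)
    show "(\<lambda>n. S - 1 / real (Suc n)) \<longlonglongrightarrow> S"
      using tendsto_diff[OF tendsto_const[of S] LIMSEQ_inverse_real_of_nat] by (simp add: inverse_eq_divide)
    show "\<forall>\<^sub>F n in sequentially. S - 1 / real (Suc n) \<le> f (X n)"
      by (intro always_eventually allI less_imp_le X)
    show "\<forall>\<^sub>F n in sequentially. f (X n) \<le> S"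
      by (intro always_eventually allI le X)
  qed simp
  obtain x r where x: "x \<in> K" "strict_mono r" "(X \<circ> r) \<longlonglongrightarrow> x"
    using \<open>compact K\<close> X(1) unfolding compact_def by blast
  have "(\<lambda>n. f ((X \<circ> r) n)) \<longlonglongrightarrow> S"
    using LIMSEQ_subseq_LIMSEQ[OF lim x(2)] by (simp add: o_def)
  then have "S \<le> f x"
    using usc[of "X \<circ> r" x S] X(1) x by auto
  then show ?thesis
    using le x(1) by (meson order_trans)
qed

text \<open>Upper semicontinuity by continuity from above: the unions of tails decrease to the limit
  superior of the sets, which lies in the limiting sublevel set because a non-strict inequality
  survives limits. Their measures give a convergent majorant \<open>b\<close>, which can be fed into
  continuous monotone functions.\<close>

lemma sub_mes_limsup:
  assumes \<phi>: "\<And>j. j < m \<Longrightarrow> (\<lambda>n. \<Phi> n j) \<longlonglongrightarrow> \<phi> j" and h: "H \<longlonglongrightarrow> h"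
  shows "\<exists>b l. b \<longlonglongrightarrow> l \<and> l \<le> sub_mes m \<phi> h \<and> 0 \<le> l \<and>
    (\<forall>n. sub_mes m (\<Phi> n) (H n) \<le> b n \<and> b n \<le> 2 * pi)"
proof -
  define A where "A n = sublevel m (\<Phi> n) (H n) \<inter> {0..<2*pi}" for n
  define B where "B n = (\<Union>k\<in>{n..}. A k)" for n
  have Am: "A n \<in> sets lebesgue" for n by (simp add: A_def fmeasurableD)
  have Bm: "B n \<in> sets lebesgue" for n unfolding B_def using Am by auto
  have Bsub: "B n \<subseteq> {0..<2*pi}" for n by (auto simp: B_def A_def)
  have Bl: "B n \<in> lmeasurable" for n
    using Bm Bsub by (intro bounded_set_imp_lmeasurable bounded_subset[OF bounded_closed_interval[of 0 "2*pi"]]) force+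
  have lim: "(\<lambda>n. measure lebesgue (B n)) \<longlonglongrightarrow> measure lebesgue (\<Inter>n. B n)"
  proof (rule Lim_measure_decseq)
    show "decseq B" unfolding decseq_def B_def by (auto intro: order_trans)
    show "emeasure lebesgue (B n) \<noteq> \<infinity>" for n
      using fmeasurableD2[OF Bl[of n]] by simp
  qed (use Bm in auto)
  have sub: "(\<Inter>n. B n) \<subseteq> sublevel m \<phi> h \<inter> {0..<2*pi}"
  proof
    fix x assume x: "x \<in> (\<Inter>n. B n)"
    have T: "(\<lambda>n. \<bar>sine_prod m (\<Phi> n) x\<bar> - H n) \<longlonglongrightarrow> \<bar>sine_prod m \<phi> x\<bar> - h"
      unfolding sine_prod_def using \<phi> h by (auto intro!: tendsto_intros)
    have "\<bar>sine_prod m \<phi> x\<bar> - h \<le> 0"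
    proof (rule ccontr)
      assume "\<not> ?thesis"
      then have "\<forall>\<^sub>F n in sequentially. 0 < \<bar>sine_prod m (\<Phi> n) x\<bar> - H n"
        using order_tendstoD(1)[OF T, of 0] by simp
      then obtain N where N: "\<And>n. N \<le> n \<Longrightarrow> 0 < \<bar>sine_prod m (\<Phi> n) x\<bar> - H n"
        by (auto simp: eventually_sequentially)
      obtain k where "N \<le> k" "x \<in> A k" using x by (auto simp: B_def)
      then show False using N[of k] by (simp add: A_def sublevel_def)
    qed
    then show "x \<in> sublevel m \<phi> h \<inter> {0..<2*pi}"
      using x Bsub[of 0] by (auto simp: sublevel_def)
  qed
  show ?thesis
  proof (intro exI conjI allI, rule lim)
    show "measure lebesgue (\<Inter>n. B n) \<le> sub_mes m \<phi> h"
      unfolding sub_mes_def using sub Bm by (intro measure_mono_fmeasurable) auto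
    show "sub_mes m (\<Phi> n) (H n) \<le> measure lebesgue (B n)" for n
      unfolding sub_mes_def using Am Bl by (intro measure_mono_fmeasurable) (auto simp: B_def A_def)
    show "measure lebesgue (B n) \<le> 2 * pi" for n
      using measure_mono_fmeasurable[OF Bsub Bm, of n] bounded_set_imp_lmeasurable[of "{0..<2*pi}"] by simp
    show "0 \<le> measure lebesgue (\<Inter>n. B n)"
      by simp
  qed
qed

section \<open>Maximizing the quotient along the flow\<close>

lemma sin_quarter_power_mono:
  assumes "0 \<le> a" "a \<le> b" "b \<le> 2 * pi"
  shows "sin (a / 4) ^ m \<le> sin (b / 4) ^ m"
proof (rule power_mono)
  show "sin (a / 4) \<le> sin (b / 4)"
    by (rule sin_monotone_2pi_le) (use assms pi_gt_zero in linarith)+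
  show "0 \<le> sin (a / 4)"
    by (rule sin_ge_zero) (use assms pi_gt_zero in linarith)+
qed

text \<open>For positive \<open>h\<close> the sharp bound reads
  \<open>quot m 1 \<phi> h \<le> 1 / 2\<close>. An exponent \<open>p < 1\<close> leaves room for the
  flow to increase the quotient strictly even when the bathtub inequality is an equality.\<close>

definition quot :: "nat \<Rightarrow> real \<Rightarrow> (nat \<Rightarrow> real) \<Rightarrow> real \<Rightarrow> real" where
  "quot m p \<phi> h = sin (sub_mes m \<phi> h / 4) ^ m / h powr p"

text \<open>With \<open>s = sub_mes m \<phi> h / 4\<close>, the logarithm of the quotient has lower
  bound of slope \<open>m * (W / 4) * cot s - p * m / 2\<close> at \<open>e = 0\<close>, which is
  positive exactly when \<open>p * (2 * tan s) < W\<close>. A choice \<open>p < 1\<close> gives the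
  sharp bound, \<open>p = 1\<close> its equality case.\<close>

lemma quot_improve:
  assumes m: "m \<ge> 1" and h: "0 < h" "h < 2" and b0: "0 < sub_mes m \<phi> h"
  obtains u W where "2 * tan (sub_mes m \<phi> h / 4) \<le> W"
    "W = 2 * tan (sub_mes m \<phi> h / 4) \<Longrightarrow>
      {- sub_mes m \<phi> h / 2 <..< sub_mes m \<phi> h / 2} \<subseteq> sublevel m (\<lambda>j. \<phi> j - u) h"
    "\<And>p. p * (2 * tan (sub_mes m \<phi> h / 4)) < W \<Longrightarrow> \<exists>\<psi> h'. h \<le> h' \<and> h' \<le> 2 \<and> quot m p \<phi> h < quot m p \<psi> h'"
proof -
  obtain u W C e0 where C: "0 \<le> C" and e0: "0 < e0" and b1: "sub_mes m \<phi> h < 2 * pi"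
    and W: "2 * tan (sub_mes m \<phi> h / 4) \<le> W"
    and arc: "W = 2 * tan (sub_mes m \<phi> h / 4) \<Longrightarrow>
      {- sub_mes m \<phi> h / 2 <..< sub_mes m \<phi> h / 2} \<subseteq> sublevel m (\<lambda>j. \<phi> j - u) h"
    and step: "\<And>e. 0 < e \<Longrightarrow> e < e0 \<Longrightarrow>
      \<exists>\<psi>. sub_mes m \<phi> h + e * W \<le> sub_mes m \<psi> (h * exp (real m * e / 2 + C * e\<^sup>2))"
    by (rule sub_mes_flow_step[OF m h(2), of \<phi>]) (rule that)
  define s where "s = sub_mes m \<phi> h / 4"
  have s: "0 < s" "s < pi / 2" using b0 b1 by (auto simp: s_def)
  have sc: "0 < sin s" "0 < cos s" "0 < tan s"
    using s by (auto intro!: sin_gt_zero cos_gt_zero tan_gt_zero)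
  have W0: "0 < W" using W sc(3) by (simp add: s_def)
  show thesis
  proof (rule that[OF W arc])
    fix p assume p: "p * (2 * tan (sub_mes m \<phi> h / 4)) < W"
    define q where "q e = real m * e / 2 + C * e\<^sup>2" for e
    \<comment> \<open>The logarithm of a lower bound for the quotient after flow time
      \<open>e\<close>, up to the constant \<open>- p * ln h\<close>; the quadratic error in
      \<open>q\<close> does not affect its slope at 0.\<close>
    define f where "f e = real m * ln (sin (s + e * W / 4)) - p * q e" for e
    have "((\<lambda>e. real m * ln (sin (s + e * W / 4)) - p * (real m * e / 2 + C * e\<^sup>2)) has_field_derivative
        m * (W / 4 * cos s / sin s) - p * (m / 2)) (at 0)"
      using sc by (auto intro!: derivative_eq_intros simp: field_simps)
    then have D: "(f has_field_derivative m * (W / 4 * cos s / sin s) - p * (m / 2)) (at 0)"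
      by (simp add: f_def[abs_def] q_def)
    have "p * (m / 2) < m * (W / 4 * cos s / sin s)"
    proof -
      have "p * (2 * (sin s / cos s)) < W"
        using p by (simp add: s_def tan_def)
      then have "p / 2 < W / 4 * cos s / sin s"
        using sc by (simp add: field_simps)
      then have "m * (p / 2) < m * (W / 4 * cos s / sin s)"
        using m by (intro mult_strict_left_mono) auto
      then show ?thesis by (simp add: algebra_simps)
    qed
    then obtain d where d: "0 < d" "\<And>e. 0 < e \<Longrightarrow> e < d \<Longrightarrow> f 0 < f e"
      using DERIV_pos_inc_right[OF D] by auto
    have "((\<lambda>e. h * exp (q e)) \<longlongrightarrow> h * exp (q 0)) (at_right 0)"
      unfolding q_def by (intro tendsto_intros) auto
    then have "((\<lambda>e. h * exp (q e)) \<longlongrightarrow> h) (at_right 0)"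
      by (simp add: q_def)
    then have "\<forall>\<^sub>F e in at_right 0. h * exp (q e) < 2"
      using h by (intro order_tendstoD) auto
    moreover have "\<forall>\<^sub>F e in at_right 0. e < min d e0"
      unfolding eventually_at_right_field using d(1) e0 by (intro exI[of _ "min d e0"]) auto
    moreover have "\<forall>\<^sub>F e::real in at_right 0. 0 < e"
      by (simp add: eventually_at_right_less)
    ultimately have "\<forall>\<^sub>F e in at_right 0. 0 < e \<and> e < min d e0 \<and> h * exp (q e) < 2"
      by eventually_elim auto
    then obtain e where e: "0 < e" "e < d" "e < e0" "h * exp (q e) < 2"
      using eventually_happens'[OF trivial_limit_at_right_real] by auto
    obtain \<psi> where \<psi>: "sub_mes m \<phi> h + e * W \<le> sub_mes m \<psi> (h * exp (q e))"
      using step[OF e(1,3)] by (auto simp: q_def)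
    define s' where "s' = s + e * W / 4"
    have s'_le: "s' \<le> sub_mes m \<psi> (h * exp (q e)) / 4"
      using \<psi> by (simp add: s'_def s_def)
    have ss': "s < s'" using e W0 by (simp add: s'_def)
    have s'_pi: "s' \<le> pi / 2"
      using s'_le sub_mes_le[of m \<psi> "h * exp (q e)"] by simp
    have sin': "0 < sin s'" using ss' s s'_pi by (intro sin_gt_zero) auto
    have q0: "0 \<le> q e" using e C by (simp add: q_def)
    have "real m * ln (sin s) < real m * ln (sin s') - p * q e"
      using d(2)[OF e(1,2)] by (simp add: f_def s'_def q_def)
    then have "exp (real m * ln (sin s)) < exp (real m * ln (sin s') - p * q e)"
      by simp
    then have lt: "sin s ^ m < sin s' ^ m / exp (p * q e)"
      using sc sin' by (simp add: exp_diff exp_of_nat_mult)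
    have pw: "(h * exp (q e)) powr p = h powr p * exp (p * q e)"
      using h by (simp add: powr_mult) (simp add: powr_def)
    have "quot m p \<phi> h = sin s ^ m / h powr p"
      by (simp add: quot_def s_def)
    also have "\<dots> < (sin s' ^ m / exp (p * q e)) / h powr p"
      using lt h by (intro divide_strict_right_mono) auto
    also have "\<dots> = sin s' ^ m / (h * exp (q e)) powr p"
      by (simp add: pw)
    also have "\<dots> \<le> quot m p \<psi> (h * exp (q e))"
      unfolding quot_def
      using sin_quarter_power_mono[of "4 * s'" "sub_mes m \<psi> (h * exp (q e))" m] ss' s s'_le sub_mes_le[of m \<psi> "h * exp (q e)"]
      by (intro divide_right_mono) auto
    finally have "quot m p \<phi> h < quot m p \<psi> (h * exp (q e))" .
    moreover have "h \<le> h * exp (q e)" using h q0 by simp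
    ultimately show "\<exists>\<psi> h'. h \<le> h' \<and> h' \<le> 2 \<and> quot m p \<phi> h < quot m p \<psi> h'"
      using e(4) by (intro exI[of _ \<psi>] exI[of _ "h * exp (q e)"]) auto
  qed
qed

lemma exists_angle_in_0_2pi: "\<exists>x\<in>{0..2*pi}. cis x = cis t"
proof -
  define k where "k = \<lfloor>t / (2 * pi)\<rfloor>"
  have "of_int k \<le> t / (2 * pi)" "t / (2 * pi) < of_int k + 1"
    by (auto simp: k_def)
  then have "t + 2 * pi * of_int (- k) \<in> {0..2*pi}"
    by (auto simp: field_simps)
  moreover have "cis (t + 2 * pi * of_int (- k)) = cis t"
    using cis_mult[of t "2 * pi * of_int (- k)"] cis_multiple_2pi[of "of_int (- k)"] by simp
  ultimately show ?thesis by blast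
qed

lemma sub_mes_reduce: "\<exists>\<psi>. (\<forall>j. \<psi> j \<in> {0..2*pi}) \<and> (\<forall>h. sub_mes m \<psi> h = sub_mes m \<phi> h)"
proof -
  have "\<forall>j. \<exists>x. x \<in> {0..2*pi} \<and> cis x = cis (\<phi> j)"
    using exists_angle_in_0_2pi by blast
  from choice[OF this] obtain \<psi> where "\<forall>j. \<psi> j \<in> {0..2*pi} \<and> cis (\<psi> j) = cis (\<phi> j)" ..
  then show ?thesis
    by (intro exI[of _ \<psi>]) (auto intro!: sub_mes_cong)
qed

text \<open>Angles are functions on all of \<open>nat\<close>, so compactness of the cube is
  Tychonoff's theorem; \<open>sub_mes_limsup\<close> supplies upper semicontinuity, and
  \<open>h0 > 0\<close> keeps the denominator away from 0. Other angles are reduced modulo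
  \<open>2 * pi\<close> into the cube.\<close>

lemma quot_attains_max:
  assumes "0 < h0" "h0 \<le> 2" "0 < p"
  obtains \<phi> h where "h0 \<le> h" "h \<le> 2" "\<And>\<psi> h'. h0 \<le> h' \<Longrightarrow> h' \<le> 2 \<Longrightarrow> quot m p \<psi> h' \<le> quot m p \<phi> h"
proof -
  define K where "K = {\<phi> :: nat \<Rightarrow> real. \<forall>j. \<phi> j \<in> {0..2*pi}} \<times> {h0..2}"
  have "{\<phi> :: nat \<Rightarrow> real. \<forall>j. \<phi> j \<in> {0..2*pi}} = PiE UNIV (\<lambda>_. {0..2*pi})"
    by (auto simp: PiE_def Pi_def)
  moreover have "compactin (product_topology (\<lambda>_::nat. euclidean) UNIV) (PiE UNIV (\<lambda>_. {0..2*pi::real}))"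
    by (subst compactin_PiE) auto
  ultimately have "compact {\<phi> :: nat \<Rightarrow> real. \<forall>j. \<phi> j \<in> {0..2*pi}}"
    by (metis compactin_euclidean_iff euclidean_product_topology)
  then have "compact K"
    unfolding K_def by (intro compact_Times) auto
  have "\<exists>x\<in>K. \<forall>y\<in>K. (\<lambda>(\<phi>, h). quot m p \<phi> h) y \<le> (\<lambda>(\<phi>, h). quot m p \<phi> h) x"
  proof (rule usc_attains_sup[OF \<open>compact K\<close>])
    have "(\<lambda>_. 0, 2) \<in> K" using assms by (auto simp: K_def)
    then show "K \<noteq> {}" by blast
    show "(\<lambda>(\<phi>, h). quot m p \<phi> h) x \<le> 1 / h0 powr p" if "x \<in> K" for x
    proof -
      obtain \<phi> h where x: "x = (\<phi>, h)" by (cases x)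
      have "sin (sub_mes m \<phi> h / 4) ^ m \<le> 1"
        using sub_mes_nonneg[of m \<phi> h] sub_mes_le[of m \<phi> h]
        by (intro power_le_one sin_ge_zero) auto
      moreover have "h0 powr p \<le> h powr p"
        using that assms x by (intro powr_mono2) (auto simp: K_def)
      ultimately have "quot m p \<phi> h \<le> 1 / h0 powr p"
        unfolding quot_def using assms by (intro frac_le) auto
      then show ?thesis by (simp add: x)
    qed
    fix X :: "nat \<Rightarrow> (nat \<Rightarrow> real) \<times> real" and x l
    assume X: "\<And>n. X n \<in> K" "x \<in> K" "X \<longlonglongrightarrow> x" "(\<lambda>n. (\<lambda>(\<phi>, h). quot m p \<phi> h) (X n)) \<longlonglongrightarrow> l"
    have h: "(\<lambda>n. snd (X n)) \<longlonglongrightarrow> snd x"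
      using X(3) by (rule tendsto_snd)
    have X_j: "(\<lambda>n. fst (X n) j) \<longlonglongrightarrow> fst x j" if "j < m" for j
    proof -
      have "isCont (\<lambda>\<phi> :: nat \<Rightarrow> real. \<phi> j) (fst x)"
        using continuous_on_product_coordinates[of j] continuous_on_eq_continuous_at[OF open_UNIV, of "\<lambda>\<phi> :: nat \<Rightarrow> real. \<phi> j"]
        by (metis UNIV_I)
      then show ?thesis
        using isCont_tendsto_compose[OF _ tendsto_fst[OF X(3)]] by blast
    qed
    obtain b L where b: "b \<longlonglongrightarrow> L" "L \<le> sub_mes m (fst x) (snd x)" "0 \<le> L"
        "\<And>n. sub_mes m (fst (X n)) (snd (X n)) \<le> b n" "\<And>n. b n \<le> 2 * pi"
      using sub_mes_limsup[of m "\<lambda>n. fst (X n)" "fst x" "\<lambda>n. snd (X n)" "snd x", OF X_j h] by blast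
    have hpos: "0 < snd x" "0 < snd (X n)" for n
      using X(1)[of n] X(2) assms by (auto simp: K_def)
    have lim: "(\<lambda>n. sin (b n / 4) ^ m / snd (X n) powr p) \<longlonglongrightarrow> sin (L / 4) ^ m / snd x powr p"
      using hpos by (intro tendsto_intros b h) auto
    have "l \<le> sin (L / 4) ^ m / snd x powr p"
    proof (rule LIMSEQ_le[OF X(4) lim], intro exI allI impI)
      fix n
      show "(\<lambda>(\<phi>, h). quot m p \<phi> h) (X n) \<le> sin (b n / 4) ^ m / snd (X n) powr p"
        unfolding quot_def case_prod_beta
        by (intro divide_right_mono sin_quarter_power_mono sub_mes_nonneg b) auto
    qed
    also have "\<dots> \<le> quot m p (fst x) (snd x)"
      unfolding quot_def by (intro divide_right_mono sin_quarter_power_mono sub_mes_le b) auto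
    finally show "l \<le> (\<lambda>(\<phi>, h). quot m p \<phi> h) x"
      by (simp add: case_prod_beta)
  qed
  then obtain x where "x \<in> K" "\<forall>y\<in>K. (\<lambda>(\<phi>, h). quot m p \<phi> h) y \<le> (\<lambda>(\<phi>, h). quot m p \<phi> h) x"
    by blast
  moreover obtain \<phi> h where "x = (\<phi>, h)"
    by (cases x)
  ultimately have max: "(\<phi>, h) \<in> K" "\<And>\<psi> h'. (\<psi>, h') \<in> K \<Longrightarrow> quot m p \<psi> h' \<le> quot m p \<phi> h"
    by auto
  show thesis
  proof (rule that[of h \<phi>])
    show "h0 \<le> h" "h \<le> 2" using max(1) by (auto simp: K_def)
    show "quot m p \<psi> h' \<le> quot m p \<phi> h" if "h0 \<le> h'" "h' \<le> 2" for \<psi> h'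
    proof -
      obtain \<psi>' where "\<forall>j. \<psi>' j \<in> {0..2*pi}" "\<forall>h. sub_mes m \<psi>' h = sub_mes m \<psi> h"
        using sub_mes_reduce by blast
      then show ?thesis
        using max(2)[of \<psi>' h'] that by (auto simp: K_def quot_def)
    qed
  qed
qed

text \<open>If the bound fails, \<open>(h / 2) powr p\<close> is still too small as a bound for some
  \<open>p < 1\<close>. A maximum of \<open>quot m p\<close> over heights from \<open>h\<close> to 2
  then exceeds \<open>1 / 2 powr p\<close>, the most that height 2 allows. It lies at a height below
  2, where the flow increases the quotient further.\<close>

theorem sin_sub_mes_le:
  assumes m: "m \<ge> 1" and h: "0 < h" "h \<le> 2"
  shows "sin (sub_mes m \<phi> h / 4) ^ m \<le> h / 2"
proof (rule ccontr)
  assume neg: "\<not> ?thesis"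
  define L where "L = sin (sub_mes m \<phi> h / 4) ^ m"
  have L: "h / 2 < L" using neg by (simp add: L_def)
  have L1: "L \<le> 1"
    unfolding L_def using sub_mes_nonneg[of m \<phi> h] sub_mes_le[of m \<phi> h]
    by (intro power_le_one sin_ge_zero) auto
  have h2: "h < 2" using L L1 by linarith
  \<comment> \<open>\<open>c\<close> solves \<open>(h / 2) powr c = L\<close>. The base is below 1,
    so any \<open>p\<close> between \<open>c\<close> and 1 gives \<open>(h / 2) powr p < L\<close>;
    \<open>p\<close> is taken as the midpoint.\<close>
  define c where "c = ln L / ln (h / 2)"
  define p where "p = (1 + c) / 2"
  have ln: "ln (h / 2) < 0" "ln (h / 2) < ln L" "ln L \<le> 0"
    using h h2 L L1 by (auto simp: ln_less_zero)
  have c: "0 \<le> c" "c < 1"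
    using ln by (auto simp: c_def divide_nonpos_neg neg_divide_less_eq)
  have p: "0 < p" "p < 1" "c < p" using c by (auto simp: p_def)
  have "p * ln (h / 2) < c * ln (h / 2)"
    using p ln by (intro mult_strict_right_mono_neg) auto
  also have "\<dots> = ln L" using ln by (simp add: c_def)
  finally have "exp (p * ln (h / 2)) < exp (ln L)" by simp
  then have "(h / 2) powr p < L"
    using h L by (simp add: powr_def)
  then have start: "1 / 2 powr p < quot m p \<phi> h"
    using h by (simp add: quot_def L_def powr_divide field_simps)
  obtain \<psi> k where k: "h \<le> k" "k \<le> 2"
    and max: "\<And>\<psi>' h'. h \<le> h' \<Longrightarrow> h' \<le> 2 \<Longrightarrow> quot m p \<psi>' h' \<le> quot m p \<psi> k"
    by (rule quot_attains_max[OF h p(1), of m]) (rule that)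
  have big: "1 / 2 powr p < quot m p \<psi> k"
    using start max[of h \<phi>] h by auto
  have "k < 2"
  proof (rule ccontr)
    assume "\<not> k < 2"
    then have "k = 2" using k by simp
    moreover have "sin (sub_mes m \<psi> 2 / 4) ^ m \<le> 1"
      using sub_mes_nonneg[of m \<psi> 2] sub_mes_le[of m \<psi> 2]
      by (intro power_le_one sin_ge_zero) auto
    ultimately show False
      using big by (auto simp: quot_def divide_less_cancel)
  qed
  have "sub_mes m \<psi> k \<noteq> 0"
  proof
    assume "sub_mes m \<psi> k = 0"
    then have "quot m p \<psi> k = 0" using m by (simp add: quot_def)
    moreover have "0 < 1 / (2::real) powr p" by simp
    ultimately show False using big by linarith
  qed
  then have b0: "0 < sub_mes m \<psi> k"
    using sub_mes_nonneg[of m \<psi> k] by linarith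
  have k0: "0 < k" using h k by simp
  obtain u W where W: "2 * tan (sub_mes m \<psi> k / 4) \<le> W"
    and imp: "p * (2 * tan (sub_mes m \<psi> k / 4)) < W \<Longrightarrow> \<exists>\<psi>' h'. k \<le> h' \<and> h' \<le> 2 \<and> quot m p \<psi> k < quot m p \<psi>' h'"
    by (rule quot_improve[OF m k0 \<open>k < 2\<close> b0]) (rule that)
  have "sub_mes m \<psi> k < 2 * pi"
    by (rule sub_mes_flow_step[OF m \<open>k < 2\<close>, of \<psi>])
  then have "0 < tan (sub_mes m \<psi> k / 4)"
    using b0 by (intro tan_gt_zero) auto
  then have "p * (2 * tan (sub_mes m \<psi> k / 4)) < 1 * (2 * tan (sub_mes m \<psi> k / 4))"
    using p by (intro mult_strict_right_mono) auto
  then obtain \<psi>' h' where "k \<le> h'" "h' \<le> 2" "quot m p \<psi> k < quot m p \<psi>' h'"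
    using imp W by auto
  then show False
    using max[of h' \<psi>'] k by auto
qed

text \<open>Equality means that \<open>quot m 1\<close> has its largest possible value
  \<open>1 / 2\<close>. The flow cannot increase it, so \<open>W\<close> equals its bathtub minimum,
  and the equality case of the bathtub principle yields the arc.\<close>

lemma extremal_contains_arc:
  assumes m: "m \<ge> 1" and h: "0 < h" "h < 2" and eq: "sin (sub_mes m \<phi> h / 4) ^ m = h / 2"
  obtains u where "{- sub_mes m \<phi> h / 2 <..< sub_mes m \<phi> h / 2} \<subseteq> sublevel m (\<lambda>j. \<phi> j - u) h"
proof -
  have "sub_mes m \<phi> h \<noteq> 0"
    using eq h m by (auto simp: power_0_left)
  then have b0: "0 < sub_mes m \<phi> h" using sub_mes_nonneg[of m \<phi> h] by linarith
  obtain u W where W: "2 * tan (sub_mes m \<phi> h / 4) \<le> W"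
    and arc: "W = 2 * tan (sub_mes m \<phi> h / 4) \<Longrightarrow>
      {- sub_mes m \<phi> h / 2 <..< sub_mes m \<phi> h / 2} \<subseteq> sublevel m (\<lambda>j. \<phi> j - u) h"
    and imp: "\<And>p. p * (2 * tan (sub_mes m \<phi> h / 4)) < W \<Longrightarrow> \<exists>\<psi> h'. h \<le> h' \<and> h' \<le> 2 \<and> quot m p \<phi> h < quot m p \<psi> h'"
    by (rule quot_improve[OF m h b0]) (rule that)
  have "\<not> 2 * tan (sub_mes m \<phi> h / 4) < W"
  proof
    assume "2 * tan (sub_mes m \<phi> h / 4) < W"
    then obtain \<psi> h' where *: "h \<le> h'" "h' \<le> 2" "quot m 1 \<phi> h < quot m 1 \<psi> h'"
      using imp[of 1] by auto
    have "sin (sub_mes m \<psi> h' / 4) ^ m \<le> h' / 2"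
      using * h by (intro sin_sub_mes_le m) auto
    then have "quot m 1 \<psi> h' \<le> 1 / 2"
      using * h by (simp add: quot_def field_simps)
    moreover have "quot m 1 \<phi> h = 1 / 2"
      using eq h by (simp add: quot_def)
    ultimately show False using *(3) by simp
  qed
  then show thesis
    using arc W that by auto
qed

section \<open>Alternation and uniqueness\<close>

text \<open>Induction on \<open>n\<close>: a root between the first two nodes is divided out and one
  of these nodes dropped, after which the quotient again alternates up to sign. Weak signs are
  needed because the two functions to be compared may touch at nodes.\<close>

lemma weakly_alternating_imp_eq_0:
  fixes p :: "real poly" and x :: "nat \<Rightarrow> real"
  assumes "degree p < n" "\<And>i j. i < j \<Longrightarrow> j \<le> n \<Longrightarrow> x i < x j" "\<And>i. i \<le> n \<Longrightarrow> 0 \<le> (-1) ^ i * poly p (x i)"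
  shows "p = 0"
  using assms
proof (induction n arbitrary: p x)
  case (Suc n)
  show ?case
  proof (rule ccontr)
    assume "p \<noteq> 0"
    have factor: "\<exists>q. p = [:- r, 1:] * q \<and> degree q < n" if root: "poly p r = 0" for r
    proof -
      obtain q where q: "p = [:- r, 1:] * q"
        using root unfolding poly_eq_0_iff_dvd by (elim dvdE)
      have "q \<noteq> 0" using \<open>p \<noteq> 0\<close> q by (metis mult_zero_right)
      then have "degree p = Suc (degree q)"
        unfolding q by (subst degree_mult_eq) auto
      then have "degree q < n" using Suc.prems(1) by linarith
      then show ?thesis using q by blast
    qed
    \<comment> \<open>The hypothesis is applied to \<open>- q\<close>; multiplying
      \<open>- q\<close> by the square of \<open>y i - r\<close> gives
      \<open>- (y i - r) * p\<close>, so only the signs of \<open>p\<close> and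
      \<open>y i - r\<close> have to be known.\<close>
    have contra: False if root: "poly p r = 0" and mono: "\<And>i j. i < j \<Longrightarrow> j \<le> n \<Longrightarrow> y i < y j"
      and sgn: "\<And>i. i \<le> n \<Longrightarrow> 0 \<le> (-1) ^ i * (- ((y i - r) * poly p (y i))) \<and> y i \<noteq> r" for r y
    proof -
      obtain q where q: "p = [:- r, 1:] * q" "degree q < n"
        using factor[OF root] by blast
      have "- q = 0"
      proof (rule Suc.IH)
        show "degree (- q) < n" using q(2) by simp
        show "y i < y j" if "i < j" "j \<le> n" for i j by (rule mono[OF that])
        fix i assume "i \<le> n"
        then have "0 \<le> (-1) ^ i * (- ((y i - r) * poly p (y i)))" "y i \<noteq> r" using sgn by auto
        moreover have "(-1) ^ i * (- ((y i - r) * poly p (y i))) = (y i - r)\<^sup>2 * ((-1) ^ i * poly (- q) (y i))"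
          by (simp add: q(1) power2_eq_square algebra_simps)
        ultimately have "0 \<le> (y i - r)\<^sup>2 * ((-1) ^ i * poly (- q) (y i))" "0 < (y i - r)\<^sup>2"
          by (simp_all only: zero_less_power2 right_minus_eq not_False_eq_True)
        then show "0 \<le> (-1) ^ i * poly (- q) (y i)"
          by (metis mult_le_cancel_left_pos mult_zero_right)
      qed
      then show False using \<open>p \<noteq> 0\<close> q(1) by (metis mult_zero_right neg_equal_0_iff_equal)
    qed
    have s: "x 0 < x (Suc 0)" using Suc.prems(2)[of 0 1] by simp
    have p0: "0 \<le> poly p (x 0)" and p1: "poly p (x (Suc 0)) \<le> 0"
      using Suc.prems(3)[of 0] Suc.prems(3)[of 1] by auto
    have pS: "0 \<le> (-1) ^ i * - ((x (Suc i) - r) * poly p (x (Suc i)))" if "i \<le> n" "r < x (Suc i)" for i r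
    proof -
      have "0 \<le> (x (Suc i) - r) * ((-1) ^ Suc i * poly p (x (Suc i)))"
        by (rule mult_nonneg_nonneg) (use Suc.prems(3)[of "Suc i"] that in simp_all)
      then show ?thesis by (simp add: mult.left_commute)
    qed
    show False
    proof (cases "poly p (x (Suc 0)) = 0")
      \<comment> \<open>The second node is the root and is dropped. The values at its two neighbours
        have the same weak sign, but the neighbours lie on opposite sides of the root, so the
        quotient alternates.\<close>
      case True
      show False
      proof (rule contra[OF True, of "\<lambda>i. if i = 0 then x 0 else x (Suc i)"])
        fix i j :: nat assume "i < j" "j \<le> n"
        then show "(if i = 0 then x 0 else x (Suc i)) < (if j = 0 then x 0 else x (Suc j))"
          using Suc.prems(2) by auto
      next
        fix i assume "i \<le> n"
        show "0 \<le> (-1) ^ i * (- (((if i = 0 then x 0 else x (Suc i)) - x (Suc 0)) * poly p (if i = 0 then x 0 else x (Suc i))))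
            \<and> (if i = 0 then x 0 else x (Suc i)) \<noteq> x (Suc 0)"
        proof (cases "i = 0")
          case True
          have "0 \<le> (x (Suc 0) - x 0) * poly p (x 0)"
            using s p0 by simp
          then show ?thesis using True s by (simp add: algebra_simps)
        next
          case False
          then have "x (Suc 0) < x (Suc i)" using Suc.prems(2) \<open>i \<le> n\<close> by auto
          then show ?thesis using False pS[OF \<open>i \<le> n\<close>, of "x (Suc 0)"] by simp
        qed
      qed
    next
      \<comment> \<open>The root lies strictly before the second node. The first node is dropped,
        and all remaining nodes lie to the right of the root.\<close>
      case False
      have "continuous_on {x 0..x (Suc 0)} (poly p)"
        by (rule continuous_on_poly[OF continuous_on_id])
      then obtain r where r: "x 0 \<le> r" "r \<le> x (Suc 0)" "poly p r = 0"
        using IVT2'[of "poly p" "x (Suc 0)" 0 "x 0"] p0 p1 s by auto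
      then have "r < x (Suc 0)" using False by (cases "r = x (Suc 0)") auto
      moreover have "x (Suc 0) \<le> x (Suc i)" if "i \<le> n" for i
        using Suc.prems(2)[of "Suc 0" "Suc i"] that by (cases i) auto
      ultimately have "r < x (Suc i)" if "i \<le> n" for i
        using that by force
      then show False
        using Suc.prems(2) pS by (intro contra[OF r(3), of "\<lambda>i. x (Suc i)"]) force+
    qed
  qed
qed simp

section \<open>Comparison of two products through polynomials in the half-angle tangent\<close>

definition tan_poly :: "nat \<Rightarrow> (nat \<Rightarrow> real) \<Rightarrow> real poly" where
  "tan_poly m \<phi> = (\<Prod>j<m. [:- 2 * sin (\<phi> j / 2), 2 * cos (\<phi> j / 2):])"

lemma sine_prod_tan_poly:
  assumes "cos (t / 2) \<noteq> 0"
  shows "sine_prod m \<phi> t = cos (t / 2) ^ m * poly (tan_poly m \<phi>) (tan (t / 2))"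
proof -
  have "2 * sin ((t - \<phi> j) / 2) = cos (t / 2) * poly [:- 2 * sin (\<phi> j / 2), 2 * cos (\<phi> j / 2):] (tan (t / 2))" for j
  proof -
    have "sin (t / 2) = cos (t / 2) * tan (t / 2)"
      using assms by (simp add: tan_def)
    then show ?thesis
      unfolding diff_divide_distrib sin_diff by (simp only: poly_pCons poly_0) (simp add: algebra_simps)
  qed
  then show ?thesis
    unfolding sine_prod_def tan_poly_def poly_prod by (simp add: prod.distrib del: poly_pCons)
qed

lemma degree_coeff_tan_poly:
  "degree (tan_poly m \<phi>) \<le> m" "coeff (tan_poly m \<phi>) m = (\<Prod>j<m. 2 * cos (\<phi> j / 2))"
proof -
  have "degree (tan_poly m \<phi>) \<le> m \<and> coeff (tan_poly m \<phi>) m = (\<Prod>j<m. 2 * cos (\<phi> j / 2))"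
  proof (induction m)
    case (Suc m)
    have eq: "tan_poly (Suc m) \<phi> = [:- 2 * sin (\<phi> m / 2), 2 * cos (\<phi> m / 2):] * tan_poly m \<phi>"
      by (simp add: tan_poly_def mult.commute)
    have "degree (tan_poly (Suc m) \<phi>) \<le> degree [:- 2 * sin (\<phi> m / 2), 2 * cos (\<phi> m / 2):] + degree (tan_poly m \<phi>)"
      unfolding eq by (rule degree_mult_le)
    moreover have "degree [:- 2 * sin (\<phi> m / 2), 2 * cos (\<phi> m / 2):] \<le> 1"
      by simp
    moreover have "coeff (tan_poly m \<phi>) (Suc m) = 0"
      using Suc.IH by (intro coeff_eq_0) auto
    ultimately show ?case
      using Suc.IH unfolding eq by (auto simp: mult.commute)
  qed (simp add: tan_poly_def)
  then show "degree (tan_poly m \<phi>) \<le> m" "coeff (tan_poly m \<phi>) m = (\<Prod>j<m. 2 * cos (\<phi> j / 2))"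
    by auto
qed

lemma poly_root_poly_cis':
  "poly (root_poly m \<phi>) (cis t) = cis (t / 2) ^ m * (\<Prod>j<m. \<i> * cis (\<phi> j / 2)) * sine_prod m \<phi> t"
proof -
  have "\<i> * cis ((t + \<phi> j) / 2) = cis (t / 2) * (\<i> * cis (\<phi> j / 2))" for j
    by (simp add: cis_mult add_divide_distrib mult.left_commute)
  then show ?thesis
    by (simp add: poly_root_poly_cis prod.distrib)
qed

text \<open>The unimodular prefactor depends on \<open>t\<close> only through
  \<open>cis (t / 2) ^ m\<close>, so proportional products give polynomials proportional at
  infinitely many points, hence everywhere. Both are monic, so they are equal.\<close>

lemma root_poly_eqI:
  assumes "\<And>t. t \<in> {-pi<..<pi} \<Longrightarrow> sine_prod m \<phi> t = c * sine_prod m \<psi> t"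
  shows "root_poly m \<phi> = root_poly m \<psi>"
proof -
  define A where "A \<phi> = (\<Prod>j<m. \<i> * cis (\<phi> j / 2))" for \<phi> :: "nat \<Rightarrow> real"
  have A0: "A \<psi> \<noteq> 0" by (simp add: A_def)
  define g where "g = A \<phi> * c / A \<psi>"
  define R where "R = root_poly m \<phi> - smult g (root_poly m \<psi>)"
  have zero: "poly R (cis t) = 0" if "t \<in> {0<..<1}" for t
  proof -
    have "t \<in> {-pi<..<pi}" using that pi_gt3 by auto
    then show ?thesis
      using A0 unfolding R_def poly_diff poly_smult poly_root_poly_cis' A_def[symmetric]
      by (simp add: assms g_def)
  qed
  have "inj_on cis {0<..<1}"
  proof (rule inj_onI)
    fix x y :: real assume xy: "x \<in> {0<..<1}" "y \<in> {0<..<1}" "cis x = cis y"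
    then have "cos x = cos y" by (metis cis.sel(1))
    then show "x = y"
      by (rule cos_inj_pi[rotated 4]) (use xy pi_gt3 in auto)
  qed
  then have "infinite (cis ` {0<..<1::real})"
    using finite_imageD infinite_Ioo[of 0 "1::real"] by fastforce
  moreover have "cis ` {0<..<1} \<subseteq> {z. poly R z = 0}"
    using zero by auto
  ultimately have "R = 0"
    using poly_roots_finite[of R] finite_subset by blast
  then have eq: "root_poly m \<phi> = smult g (root_poly m \<psi>)"
    by (simp add: R_def)
  then have "coeff (root_poly m \<phi>) m = g * coeff (root_poly m \<psi>) m"
    by simp
  then have "g = 1" by (simp add: root_poly_lead)
  then show ?thesis using eq by simp
qed

text \<open>Scaling the second product by \<open>c\<close> makes the leading coefficients in
  \<open>tan (t / 2)\<close> agree, so the difference has degree below \<open>m\<close>.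
  \<open>K\<close> ensures \<open>c \<le> 1\<close>; hence the scaled product stays within
  \<open>h\<close> at the nodes and the difference alternates weakly there.\<close>

lemma alternating_unique_le:
  assumes roots: "\<And>j. j < m \<Longrightarrow> \<phi> j \<in> {-pi<..<pi}" "\<And>j. j < m \<Longrightarrow> \<psi> j \<in> {-pi<..<pi}"
    and K: "(\<Prod>j<m. 2 * cos (\<phi> j / 2)) \<le> (\<Prod>j<m. 2 * cos (\<psi> j / 2))"
    and s: "\<And>i. i \<le> m \<Longrightarrow> s i \<in> {-pi<..<pi}" "\<And>i j. i < j \<Longrightarrow> j \<le> m \<Longrightarrow> s i < s j"
    and alt: "\<And>i. i \<le> m \<Longrightarrow> sine_prod m \<phi> (s i) = (-1) ^ (m + i) * h"
    and bd: "\<And>i. i \<le> m \<Longrightarrow> \<bar>sine_prod m \<psi> (s i)\<bar> \<le> h" and "m \<ge> 1"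
  shows "root_poly m \<phi> = root_poly m \<psi>"
proof -
  have cpos: "0 < cos (t / 2)" if "t \<in> {-pi<..<pi}" for t :: real
    using that by (intro cos_gt_zero_pi) auto
  define c where "c = (\<Prod>j<m. 2 * cos (\<phi> j / 2)) / (\<Prod>j<m. 2 * cos (\<psi> j / 2))"
  have Kpos: "0 < (\<Prod>j<m. 2 * cos (\<phi> j / 2))" "0 < (\<Prod>j<m. 2 * cos (\<psi> j / 2))"
    using roots cpos by (auto intro!: prod_pos)
  have c: "0 < c" "c \<le> 1"
    using Kpos K by (auto simp: c_def)
  have cK: "c * (\<Prod>j<m. 2 * cos (\<psi> j / 2)) = (\<Prod>j<m. 2 * cos (\<phi> j / 2))"
    by (rule iffD1[OF nonzero_eq_divide_eq[OF Kpos(2)[THEN less_imp_neq, THEN not_sym]] c_def])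
  define p where "p = smult ((-1) ^ m) (tan_poly m \<phi> - smult c (tan_poly m \<psi>))"
  have "degree p < m"
  proof -
    have "degree p \<le> m"
      unfolding p_def using degree_coeff_tan_poly(1) by (intro order_trans[OF degree_smult_le] degree_diff_le order_trans[OF degree_smult_le]) auto
    moreover have "coeff p m = 0"
      by (simp only: p_def coeff_smult coeff_diff degree_coeff_tan_poly(2) cK) simp
    ultimately show ?thesis
      using \<open>m \<ge> 1\<close> by (cases "degree p = m") (auto simp: eq_zero_or_degree_less)
  qed
  then have "p = 0"
  proof (rule weakly_alternating_imp_eq_0[where x = "\<lambda>i. tan (s i / 2)"])
    show "tan (s i / 2) < tan (s j / 2)" if "i < j" "j \<le> m" for i j
      using s(1)[of i] s(1)[of j] s(2)[OF that] that by (intro tan_monotone) auto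
    show "0 \<le> (-1) ^ i * poly p (tan (s i / 2))" if i: "i \<le> m" for i
    proof -
      have cp: "0 < cos (s i / 2)" using s(1)[OF i] by (rule cpos)
      have "cos (s i / 2) ^ m * ((-1) ^ i * poly p (tan (s i / 2)))
        = (-1) ^ (m + i) * (sine_prod m \<phi> (s i) - c * sine_prod m \<psi> (s i))"
        using cp by (simp add: p_def sine_prod_tan_poly power_add algebra_simps)
      also have "\<dots> = h - c * ((-1) ^ (m + i) * sine_prod m \<psi> (s i))"
        by (simp add: alt[OF i] right_diff_distrib mult.assoc[symmetric] power_add[symmetric] mult.left_commute)
      also have "\<dots> \<ge> 0"
      proof -
        have "(-1) ^ (m + i) * sine_prod m \<psi> (s i) \<le> \<bar>(-1) ^ (m + i) * sine_prod m \<psi> (s i)\<bar>" by simp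
        also have "\<dots> \<le> h" using bd[OF i] by (simp add: abs_mult power_abs)
        finally have "c * ((-1) ^ (m + i) * sine_prod m \<psi> (s i)) \<le> c * h"
          using c by (intro mult_left_mono) auto
        also have "\<dots> \<le> 1 * h" using c bd[OF i] by (intro mult_right_mono) auto
        finally show ?thesis by simp
      qed
      finally show ?thesis
        using zero_less_power[OF cp, of m] by (metis mult_le_cancel_left_pos mult_zero_right)
    qed
  qed
  then have "tan_poly m \<phi> = smult c (tan_poly m \<psi>)"
    by (simp add: p_def)
  then have "sine_prod m \<phi> t = c * sine_prod m \<psi> t" if "t \<in> {-pi<..<pi}" for t
    using cpos[OF that] by (simp add: sine_prod_tan_poly)
  then show ?thesis by (rule root_poly_eqI)
qed

section \<open>Configurations whose sublevel set contains the extremal arc\<close>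

lemma sub_mes_le_extremal:
  assumes m: "m \<ge> 1" and a: "0 < a" "a < pi" and h: "h = 2 * sin (a / 2) ^ m"
  shows "sub_mes m \<phi> h \<le> 2 * a"
proof (rule ccontr)
  assume "\<not> ?thesis"
  then have "sin (a / 2) < sin (sub_mes m \<phi> h / 4)"
    using a sub_mes_le[of m \<phi> h] by (intro sin_monotone_2pi) auto
  moreover have s: "0 < sin (a / 2)" using a by (intro sin_gt_zero) auto
  ultimately have "sin (a / 2) ^ m < sin (sub_mes m \<phi> h / 4) ^ m"
    using m by (intro power_strict_mono) auto
  moreover have "sin (sub_mes m \<phi> h / 4) ^ m \<le> h / 2"
  proof (rule sin_sub_mes_le[OF m])
    show "0 < h" using s by (simp add: h)
    have "sin (a / 2) ^ m \<le> 1" using s by (intro power_le_one) auto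
    then show "h \<le> 2" by (simp add: h)
  qed
  ultimately show False by (simp add: h)
qed

lemma cos_le_cos_of_between:
  assumes "0 \<le> D" "D \<le> \<bar>x\<bar>" "\<bar>x\<bar> \<le> 2 * pi - D"
  shows "cos x \<le> cos D"
proof (cases "\<bar>x\<bar> \<le> pi")
  case True
  then have "cos \<bar>x\<bar> \<le> cos D" using assms by (intro cos_monotone_0_pi_le) auto
  then show ?thesis by simp
next
  case False
  then have "cos (2 * pi - \<bar>x\<bar>) \<le> cos D" using assms by (intro cos_monotone_0_pi_le) auto
  then show ?thesis by (simp add: cos_diff)
qed

text \<open>At this height \<open>h\<close> no sublevel set has measure above \<open>2 * a\<close>
  per period, so a configuration whose sublevel set contains \<open>{-a..a}\<close> attains the
  maximum.\<close>

locale extremal_arc =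
  fixes m :: nat and a h :: real
  assumes m: "m \<ge> 1" and a: "0 < a" "a < pi" and h: "h = 2 * sin (a / 2) ^ m"
begin

lemma h_pos: "0 < h"
proof -
  have "0 < sin (a / 2)" using a by (intro sin_gt_zero) auto
  then show ?thesis unfolding h by simp
qed

text \<open>The arc alone already has the maximal measure \<open>2 * a\<close>.\<close>

lemma sublevel_no_extra_interval:
  assumes arc: "{-a..a} \<subseteq> sublevel m \<phi> h" and cd: "c < d" "-pi \<le> c" "d \<le> pi" "d \<le> -a \<or> a \<le> c"
  shows "\<not> {c<..<d} \<subseteq> sublevel m \<phi> h"
proof
  assume sub: "{c<..<d} \<subseteq> sublevel m \<phi> h"
  have "measure lebesgue ({-a..a} \<union> {c<..<d}) \<le> measure lebesgue (sublevel m \<phi> h \<inter> {-pi..<-pi+2*pi})"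
    using arc sub cd a by (intro measure_mono_fmeasurable) auto
  also have "\<dots> \<le> 2 * a"
    using sub_mes_le_extremal[OF m a h] by (simp only: sub_mes_window[symmetric])
  also have "measure lebesgue ({-a..a} \<union> {c<..<d}) = 2 * a + (d - c)"
  proof -
    have "{-a..a} \<inter> {c<..<d} = {}" using cd by auto
    then show ?thesis
      using measure_Un3[of "{-a..a}" lebesgue "{c<..<d}"] a cd by (simp add: bounded_set_imp_lmeasurable)
  qed
  finally show False using cd by simp
qed

text \<open>By continuity a strict inequality persists on an interval around \<open>t\<close>, which
  outside the open arc would add measure.\<close>

lemma small_value_in_arc:
  assumes arc: "{-a..a} \<subseteq> sublevel m \<phi> h" and t: "\<bar>t\<bar> \<le> pi" "\<bar>sine_prod m \<phi> t\<bar> < h"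
  shows "\<bar>t\<bar> < a"
proof (rule ccontr)
  assume "\<not> ?thesis"
  then have t_ge: "a \<le> \<bar>t\<bar>" by simp
  have "open {t. \<bar>sine_prod m \<phi> t\<bar> < h}"
    by (intro open_Collect_less continuous_intros)
  then obtain e where e: "0 < e" "ball t e \<subseteq> {t. \<bar>sine_prod m \<phi> t\<bar> < h}"
    using t(2) by (metis mem_Collect_eq open_contains_ball)
  have sub: "{c<..<d} \<subseteq> sublevel m \<phi> h" if "t - e \<le> c" "d \<le> t + e" for c d
  proof
    fix x assume "x \<in> {c<..<d}"
    then have "x \<in> ball t e" using that by (auto simp: dist_real_def)
    then show "x \<in> sublevel m \<phi> h" using e(2) by (auto simp: sublevel_def)
  qed
  show False
  proof (cases "0 \<le> t")
    case True
    then have "a \<le> t" using t_ge by simp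
    show False
    \<comment> \<open>At the ends of the window \<open>[-pi, pi]\<close> only the inner half of the
      interval is available; elsewhere the half pointing away from the arc is taken.\<close>
    proof (cases "t = pi")
      case True
      then show False
        using sublevel_no_extra_interval[OF arc, of "max a (t - e)" t] sub[of "max a (t - e)" t] e a by auto
    next
      case False
      then show False
        using sublevel_no_extra_interval[OF arc, of t "min pi (t + e)"] sub[of t "min pi (t + e)"] e a t(1) \<open>a \<le> t\<close> by auto
    qed
  next
    case False
    then have "t \<le> -a" using t_ge by simp
    show False
    proof (cases "t = -pi")
      case True
      then show False
        using sublevel_no_extra_interval[OF arc, of t "min (-a) (t + e)"] sub[of t "min (-a) (t + e)"] e a by auto
    next
      case False
      then show False
        using sublevel_no_extra_interval[OF arc, of "max (-pi) (t - e)" t] sub[of "max (-pi) (t - e)" t] e a t(1) \<open>t \<le> -a\<close> by auto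
    qed
  qed
qed

lemma abs_sine_prod_endpoints:
  assumes arc: "{-a..a} \<subseteq> sublevel m \<phi> h"
  shows "\<bar>sine_prod m \<phi> a\<bar> = h" "\<bar>sine_prod m \<phi> (- a)\<bar> = h"
proof -
  have "a \<in> sublevel m \<phi> h" "-a \<in> sublevel m \<phi> h" using arc a by auto
  then show "\<bar>sine_prod m \<phi> a\<bar> = h" "\<bar>sine_prod m \<phi> (- a)\<bar> = h"
    using small_value_in_arc[OF arc, of a] small_value_in_arc[OF arc, of "-a"] a by (force simp: sublevel_def)+
qed

text \<open>Otherwise moving the two roots apart symmetrically would decrease \<open>\<bar>sine_prod m \<phi>\<bar>\<close> outside the
  interval between them while keeping it below \<open>h\<close> inside, and so enlarge the sublevel set.\<close>

lemma large_value_between_roots: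
  assumes arc: "{-a..a} \<subseteq> sublevel m \<phi> h" and ij: "i < m" "j < m" "i \<noteq> j"
    and r: "-a < \<phi> i" "\<phi> i \<le> \<phi> j" "\<phi> j < a"
  shows "\<exists>t\<in>{\<phi> i..\<phi> j}. h \<le> \<bar>sine_prod m \<phi> t\<bar>"
proof (rule ccontr)
  assume "\<not> ?thesis"
  then have small: "\<And>t. t \<in> {\<phi> i..\<phi> j} \<Longrightarrow> \<bar>sine_prod m \<phi> t\<bar> < h" by force
  \<comment> \<open>Half the distance and the midpoint of the two roots. \<open>d\<close> may be 0:
    a double root is split in the same way, so the lemma also excludes double roots in the
    arc.\<close>
  define d \<mu> where "d = (\<phi> j - \<phi> i) / 2" and "\<mu> = (\<phi> j + \<phi> i) / 2"
  define R where "R t = (\<Prod>k\<in>{..<m}-{i,j}. 2 * sin ((t - \<phi> k) / 2))" for t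
  define \<psi> where "\<psi> e = \<phi>(i := \<phi> i - e, j := \<phi> j + e)" for e
  have d: "0 \<le> d" "d < pi" "\<bar>\<mu>\<bar> + d < a"
  proof -
    have "\<mu> + d = \<phi> j" "\<mu> - d = \<phi> i" by (simp_all add: d_def \<mu>_def field_simps)
    then show "0 \<le> d" "d < pi" "\<bar>\<mu>\<bar> + d < a" using r a by linarith+
  qed
  \<comment> \<open>The two moving factors multiply to
    \<open>2 * (cos (d + e) - cos (t - \<mu>))\<close>, so moving the roots apart by
    \<open>e\<close> only changes a constant in this product.\<close>
  have T: "sine_prod m (\<psi> e) t = 2 * (cos (d + e) - cos (t - \<mu>)) * R t" for e t
  proof -
    have "sine_prod m (\<psi> e) t = (2 * sin ((t - (\<phi> i - e)) / 2)) * ((2 * sin ((t - (\<phi> j + e)) / 2)) * R t)"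
    proof -
      have "sine_prod m (\<psi> e) t = (2 * sin ((t - \<psi> e i) / 2)) * (\<Prod>k\<in>{..<m}-{i}. 2 * sin ((t - \<psi> e k) / 2))"
        unfolding sine_prod_def using ij by (subst prod.remove[of _ i]) auto
      also have "(\<Prod>k\<in>{..<m}-{i}. 2 * sin ((t - \<psi> e k) / 2))
        = (2 * sin ((t - \<psi> e j) / 2)) * (\<Prod>k\<in>{..<m}-{i}-{j}. 2 * sin ((t - \<psi> e k) / 2))"
        using ij by (subst prod.remove[of _ j]) auto
      also have "(\<Prod>k\<in>{..<m}-{i}-{j}. 2 * sin ((t - \<psi> e k) / 2)) = R t"
        unfolding R_def by (rule prod.cong) (auto simp: \<psi>_def)
      also have "\<psi> e j = \<phi> j + e" by (simp add: \<psi>_def)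
      also have "\<psi> e i = \<phi> i - e" using ij by (simp add: \<psi>_def)
      finally show ?thesis .
    qed
    also have "\<dots> = 4 * (sin ((t - (\<phi> i - e)) / 2) * sin ((t - (\<phi> j + e)) / 2)) * R t"
      by simp
    also have "sin ((t - (\<phi> i - e)) / 2) * sin ((t - (\<phi> j + e)) / 2) = (cos (d + e) - cos (t - \<mu>)) / 2"
    proof -
      have "(t - (\<phi> i - e)) / 2 - (t - (\<phi> j + e)) / 2 = d + e" "(t - (\<phi> i - e)) / 2 + (t - (\<phi> j + e)) / 2 = t - \<mu>"
        by (simp_all add: d_def \<mu>_def field_simps)
      then show ?thesis by (simp only: sin_times_sin)
    qed
    also have "4 * ((cos (d + e) - cos (t - \<mu>)) / 2) * R t = 2 * (cos (d + e) - cos (t - \<mu>)) * R t"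
      by simp
    finally show ?thesis .
  qed
  have T0: "sine_prod m \<phi> t = 2 * (cos d - cos (t - \<mu>)) * R t" for t
    using T[of 0 t] by (simp add: \<psi>_def)
  have R_le: "\<bar>R t\<bar> \<le> 2 ^ m" for t
  proof -
    have "\<bar>R t\<bar> = (\<Prod>k\<in>{..<m}-{i,j}. \<bar>2 * sin ((t - \<phi> k) / 2)\<bar>)"
      unfolding R_def by (simp add: abs_prod)
    also have "\<dots> \<le> (\<Prod>k\<in>{..<m}-{i,j}. 2)"
      by (intro prod_mono) (auto simp: abs_mult)
    also have "\<dots> = 2 ^ card ({..<m}-{i,j})" by simp
    also have "\<dots> \<le> 2 ^ m"
      using card_mono[of "{..<m}" "{..<m}-{i,j}"] by (intro power_increasing) auto
    finally show ?thesis .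
  qed
  have "continuous_on {\<phi> i..\<phi> j} (\<lambda>t. \<bar>sine_prod m \<phi> t\<bar>)"
    by (intro continuous_intros)
  then obtain t0 where t0: "t0 \<in> {\<phi> i..\<phi> j}" "\<And>t. t \<in> {\<phi> i..\<phi> j} \<Longrightarrow> \<bar>sine_prod m \<phi> t\<bar> \<le> \<bar>sine_prod m \<phi> t0\<bar>"
    using continuous_attains_sup[of "{\<phi> i..\<phi> j}" "\<lambda>t. \<bar>sine_prod m \<phi> t\<bar>"] r
    by auto
  define M where "M = (h + \<bar>sine_prod m \<phi> t0\<bar>) / 2"
  have M: "\<bar>sine_prod m \<phi> t0\<bar> < M" "M < h" using small[OF t0(1)] by (auto simp: M_def)
  have "open {t. \<bar>sine_prod m \<phi> t\<bar> < M}"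
    by (intro open_Collect_less continuous_intros)
  moreover have "\<phi> i \<in> {t. \<bar>sine_prod m \<phi> t\<bar> < M}" "\<phi> j \<in> {t. \<bar>sine_prod m \<phi> t\<bar> < M}"
    using t0(2)[of "\<phi> i"] t0(2)[of "\<phi> j"] M r by auto
  ultimately obtain e1 e2 where e12: "0 < e1" "ball (\<phi> i) e1 \<subseteq> {t. \<bar>sine_prod m \<phi> t\<bar> < M}"
      "0 < e2" "ball (\<phi> j) e2 \<subseteq> {t. \<bar>sine_prod m \<phi> t\<bar> < M}"
    by (meson open_contains_ball)
  \<comment> \<open>The first two bounds keep the points between the moved roots in the region where
    the old product is below \<open>M\<close>; the third gives \<open>d + e < pi\<close> and room
    for \<open>cos_le_cos_of_between\<close>; the last keeps the change of the product, at most
    \<open>2 * e * 2 ^ m\<close>, below \<open>h - M\<close>.\<close>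
  define e where "e = Min {e1 / 2, e2 / 2, (pi - a) / 2, (h - M) / 2 ^ (m + 2)}"
  have e: "0 < e" "e < e1" "e < e2" "e < pi - a" "2 * e * 2 ^ m < h - M"
  proof -
    show "0 < e" using e12 a M by (simp add: e_def)
    have le: "e \<le> e1 / 2" "e \<le> e2 / 2" "e \<le> (pi - a) / 2" "e \<le> (h - M) / 2 ^ (m + 2)"
      unfolding e_def by (rule Min_le; simp)+
    then show "e < e1" "e < e2" "e < pi - a" using e12 a by auto
    have "2 * e * 2 ^ m \<le> 2 * ((h - M) / 2 ^ (m + 2)) * 2 ^ m"
      using le by (intro mult_right_mono mult_left_mono) auto
    also have "\<dots> = (h - M) / 2" by (simp add: power_add)
    also have "\<dots> < h - M" using M by simp
    finally show "2 * e * 2 ^ m < h - M" .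
  qed
  have cosd: "cos (d + e) < cos d"
    using d e by (intro cos_monotone_0_pi) auto
  have diff: "cos d - cos (d + e) \<le> e"
  proof -
    have "(d + (d + e)) / 2 = d + e / 2" "(d + e - d) / 2 = e / 2" by simp_all
    then have "cos d - cos (d + e) = 2 * sin (d + e / 2) * sin (e / 2)"
      by (simp only: cos_diff_cos)
    also have "\<dots> = 2 * (sin (d + e / 2) * sin (e / 2))" by simp
    also have "\<dots> \<le> 2 * (1 * (e / 2))"
    proof (intro mult_left_mono mult_mono)
      show "sin (e / 2) \<le> e / 2" using e by (intro sin_x_le_x) auto
      show "0 \<le> sin (e / 2)" by (rule sin_ge_zero) (use e a in auto)
    qed auto
    finally show ?thesis by simp
  qed
  have inside: "\<bar>sine_prod m (\<psi> e) t\<bar> < h" if t: "\<phi> i - e \<le> t" "t \<le> \<phi> j + e" for t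
  proof -
    have "\<bar>sine_prod m \<phi> t\<bar> < M"
    proof -
      consider "t \<in> {\<phi> i..\<phi> j}" | "t \<in> ball (\<phi> i) e1" | "t \<in> ball (\<phi> j) e2"
        using t e by (force simp: dist_real_def)
      then show ?thesis
        using t0(2)[of t] M e12 by cases auto
    qed
    moreover define Y where "Y = 2 * (cos d - cos (d + e)) * R t"
    moreover have "sine_prod m (\<psi> e) t = sine_prod m \<phi> t - Y"
      unfolding T T0 Y_def by (simp add: algebra_simps)
    moreover have "\<bar>Y\<bar> \<le> 2 * e * 2 ^ m"
      using diff cosd R_le[of t] e(1) unfolding Y_def abs_mult by (intro mult_mono) auto
    then have "\<bar>Y\<bar> < h - M" using e(5) by (rule order.strict_trans1)
    ultimately show ?thesis by linarith
  qed
  have outside: "\<bar>sine_prod m (\<psi> e) t\<bar> \<le> \<bar>sine_prod m \<phi> t\<bar> \<and> (sine_prod m \<phi> t \<noteq> 0 \<longrightarrow> \<bar>sine_prod m (\<psi> e) t\<bar> < \<bar>sine_prod m \<phi> t\<bar>)"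
    if t: "\<bar>t\<bar> \<le> pi" "\<not> (\<phi> i - e \<le> t \<and> t \<le> \<phi> j + e)" for t
  proof -
    have "cos (t - \<mu>) \<le> cos (d + e)"
    proof (rule cos_le_cos_of_between)
      have "\<phi> i - e = \<mu> - (d + e)" "\<phi> j + e = \<mu> + (d + e)" by (auto simp: d_def \<mu>_def field_simps)
      then show "d + e \<le> \<bar>t - \<mu>\<bar>" using t(2) by linarith
      show "\<bar>t - \<mu>\<bar> \<le> 2 * pi - (d + e)" using t(1) d e by linarith
    qed (use d e in auto)
    then have "\<bar>cos (d + e) - cos (t - \<mu>)\<bar> < \<bar>cos d - cos (t - \<mu>)\<bar>"
      using cosd by simp
    then have "\<bar>cos (d + e) - cos (t - \<mu>)\<bar> * \<bar>R t\<bar> \<le> \<bar>cos d - cos (t - \<mu>)\<bar> * \<bar>R t\<bar>"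
      "R t \<noteq> 0 \<Longrightarrow> \<bar>cos (d + e) - cos (t - \<mu>)\<bar> * \<bar>R t\<bar> < \<bar>cos d - cos (t - \<mu>)\<bar> * \<bar>R t\<bar>"
      by (intro mult_right_mono mult_strict_right_mono; simp)+
    then show ?thesis
      unfolding T T0 abs_mult by auto
  qed
  have "{-a..a} \<subseteq> sublevel m (\<psi> e) h"
  proof
    fix t assume t: "t \<in> {-a..a}"
    then have "\<bar>sine_prod m \<phi> t\<bar> \<le> h" using arc by (auto simp: sublevel_def)
    moreover have "\<bar>t\<bar> \<le> pi" using t a by auto
    ultimately show "t \<in> sublevel m (\<psi> e) h"
      using inside[of t] outside[of t] by (cases "\<phi> i - e \<le> t \<and> t \<le> \<phi> j + e") (auto simp: sublevel_def)
  qed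
  \<comment> \<open>The moved configuration still contains the arc, so it must have absolute value
    \<open>h\<close> at the endpoint \<open>a\<close>; but the move has strictly lowered that
    value.\<close>
  then have "\<bar>sine_prod m (\<psi> e) a\<bar> = h" by (rule abs_sine_prod_endpoints)
  moreover have "\<bar>sine_prod m \<phi> a\<bar> = h" by (rule abs_sine_prod_endpoints[OF arc])
  ultimately show False
    using inside[of a] outside[of a] a h_pos by (cases "\<phi> i - e \<le> a \<and> a \<le> \<phi> j + e") auto
qed

end

text \<open>Exactly the \<open>m - i\<close> factors with \<open>j \<ge> i\<close> are negative; the
  exponent \<open>m + i\<close> has the same parity and avoids truncated subtraction.\<close>

lemma sine_prod_sign:
  assumes "i \<le> m" "\<And>j. j < i \<Longrightarrow> \<phi> j < t \<and> t < \<phi> j + 2 * pi"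
    "\<And>j. i \<le> j \<Longrightarrow> j < m \<Longrightarrow> t < \<phi> j \<and> \<phi> j - 2 * pi < t"
  shows "sine_prod m \<phi> t = (-1) ^ (m + i) * \<bar>sine_prod m \<phi> t\<bar>"
proof -
  have "2 * sin ((t - \<phi> j) / 2) = (if j < i then 1 else - 1) * \<bar>2 * sin ((t - \<phi> j) / 2)\<bar>" if "j < m" for j
  proof (cases "j < i")
    case True
    then have "0 < sin ((t - \<phi> j) / 2)" using assms(2)[of j] by (intro sin_gt_zero) auto
    then show ?thesis using True by simp
  next
    case False
    then have "0 < sin (- ((t - \<phi> j) / 2))" using assms(3)[of j] that by (intro sin_gt_zero) (auto simp: field_simps)
    then have "sin ((t - \<phi> j) / 2) < 0" by (simp only: sin_minus neg_0_less_iff_less)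
    then show ?thesis using False by simp
  qed
  then have "sine_prod m \<phi> t = (\<Prod>j<m. (if j < i then 1 else - 1) * \<bar>2 * sin ((t - \<phi> j) / 2)\<bar>)"
    unfolding sine_prod_def by (intro prod.cong) auto
  also have "\<dots> = (\<Prod>j<m. if j < i then 1 else - 1) * \<bar>sine_prod m \<phi> t\<bar>"
    unfolding sine_prod_def abs_prod by (rule prod.distrib)
  also have "(\<Prod>j<m. if j < i then 1 else - 1 :: real) = (-1) ^ card {i..<m}"
  proof -
    have "{..<m} \<inter> - {j. j < i} = {i..<m}" by auto
    then show ?thesis by (simp add: prod.If_cases)
  qed
  also have "(-1 :: real) ^ card {i..<m} = (-1) ^ (m + i)"
  proof -
    have "m + i = (m - i) + 2 * i" using assms(1) by simp
    then show ?thesis by (simp only: power_add power_mult card_atLeastLessThan) simp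
  qed
  finally show ?thesis .
qed

text \<open>Sorting the angles leaves the multiset of linear factors unchanged.\<close>

lemma root_poly_sorted_exists:
  obtains \<psi> where "root_poly m \<psi> = root_poly m \<phi>" "\<And>i j. i \<le> j \<Longrightarrow> j < m \<Longrightarrow> \<psi> i \<le> \<psi> j"
    "\<And>j. j < m \<Longrightarrow> \<exists>k<m. \<psi> j = \<phi> k"
proof -
  define xs where "xs = sort (map \<phi> [0..<m])"
  have len: "length xs = m" by (simp add: xs_def)
  have prodl: "root_poly m \<psi> = prod_list (map (\<lambda>x. [:- cis x, 1:]) (map \<psi> [0..<m]))" for \<psi>
  proof -
    have "prod_list (map (\<lambda>j. [:- cis (\<psi> j), 1:]) [0..<m]) = (\<Prod>j\<in>set [0..<m]. [:- cis (\<psi> j), 1:])"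
      by (rule prod.distinct_set_conv_list[symmetric]) simp
    then show ?thesis by (simp add: root_poly_def o_def atLeast0LessThan)
  qed
  show thesis
  proof (rule that[of "\<lambda>i. xs ! i"])
    have "map (\<lambda>i. xs ! i) [0..<m] = xs" using len by (metis map_nth)
    then have "root_poly m (\<lambda>i. xs ! i) = prod_list (map (\<lambda>x. [:- cis x, 1:]) xs)"
      by (simp only: prodl)
    also have "\<dots> = prod_mset (image_mset (\<lambda>x. [:- cis x, 1:]) (mset xs))"
      by (simp only: mset_map[symmetric] prod_mset_prod_list)
    also have "mset xs = mset (map \<phi> [0..<m])" by (simp only: xs_def mset_sort)
    also have "prod_mset (image_mset (\<lambda>x. [:- cis x, 1:]) (mset (map \<phi> [0..<m]))) = root_poly m \<phi>"
      by (simp only: prodl mset_map[symmetric] prod_mset_prod_list)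
    finally show "root_poly m (\<lambda>i. xs ! i) = root_poly m \<phi>" .
    show "xs ! i \<le> xs ! j" if "i \<le> j" "j < m" for i j
      using that len sorted_nth_mono[of xs i j] by (simp add: xs_def)
    show "\<exists>k<m. xs ! j = \<phi> k" if "j < m" for j
    proof -
      have "xs ! j \<in> set xs" using that len by simp
      then show ?thesis by (auto simp: xs_def)
    qed
  qed
qed

lemma exists_angle_in_minus_pi_pi: "\<exists>x. \<bar>x\<bar> \<le> pi \<and> cis x = cis t"
proof -
  have "cis t \<noteq> 0" by simp
  then have "cis (Arg (cis t)) = cis t" by (simp add: cis_Arg sgn_eq)
  moreover have "\<bar>Arg (cis t)\<bar> \<le> pi" using Arg_bounded[of "cis t"] by auto
  ultimately show ?thesis by blast
qed

lemma sublevel_cong: "root_poly m \<phi> = root_poly m \<psi> \<Longrightarrow> sublevel m \<phi> h = sublevel m \<psi> h"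
  unfolding sublevel_def cmod_root_poly_cis[symmetric] by simp

context extremal_arc
begin

text \<open>Equioscillation at \<open>m + 1\<close> points of the arc. The exponent
  \<open>m + i\<close> makes the value at the last point \<open>+h\<close>, the sign taken to the
  right of all roots.\<close>

definition alternating :: "(nat \<Rightarrow> real) \<Rightarrow> bool" where
  "alternating \<phi> \<longleftrightarrow> (\<forall>j<m. \<phi> j \<in> {-pi<..<pi}) \<and> {-a..a} \<subseteq> sublevel m \<phi> h \<and>
    (\<exists>s. (\<forall>i\<le>m. s i \<in> {-a..a} \<and> sine_prod m \<phi> (s i) = (-1) ^ (m + i) * h) \<and> (\<forall>i j. i < j \<longrightarrow> j \<le> m \<longrightarrow> s i < s j))"

lemma alternating_unique:
  assumes "alternating \<phi>" "alternating \<psi>"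
  shows "root_poly m \<phi> = root_poly m \<psi>"
proof -
  have *: "root_poly m \<phi> = root_poly m \<psi>"
    if A: "alternating \<phi>" "alternating \<psi>" and K: "(\<Prod>j<m. 2 * cos (\<phi> j / 2)) \<le> (\<Prod>j<m. 2 * cos (\<psi> j / 2))" for \<phi> \<psi>
  proof -
    obtain s where s: "\<And>i. i \<le> m \<Longrightarrow> s i \<in> {-a..a}" "\<And>i. i \<le> m \<Longrightarrow> sine_prod m \<phi> (s i) = (-1) ^ (m + i) * h"
        "\<And>i j. i < j \<Longrightarrow> j \<le> m \<Longrightarrow> s i < s j"
      using A(1) unfolding alternating_def by blast
    show ?thesis
    proof (rule alternating_unique_le[OF _ _ K _ s(3) s(2) _ m])
      show "\<bar>sine_prod m \<psi> (s i)\<bar> \<le> h" if "i \<le> m" for i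
        using A(2) s(1)[OF that] unfolding alternating_def sublevel_def by blast
      show "s i \<in> {-pi<..<pi}" if "i \<le> m" for i
        using s(1)[OF that] a by auto
    qed (use A in \<open>auto simp: alternating_def\<close>)
  qed
  show ?thesis
    using *[of \<phi> \<psi>] *[of \<psi> \<phi>] assms by force
qed

text \<open>At a root the product is 0, below \<open>h\<close>, so all roots lie strictly inside the
  arc. The alternation points are the two ends of the arc and one point between each pair of
  consecutive roots; point \<open>i\<close> has exactly \<open>i\<close> roots to its left, which
  fixes the sign.\<close>

lemma alternating_exists:
  assumes arc: "{-a..a} \<subseteq> sublevel m \<phi> h"
  obtains \<psi> where "alternating \<psi>" "root_poly m \<psi> = root_poly m \<phi>"
proof -
  have "\<forall>j. \<exists>x. \<bar>x\<bar> \<le> pi \<and> cis x = cis (\<phi> j)" using exists_angle_in_minus_pi_pi by blast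
  from choice[OF this] obtain \<phi>1 where \<phi>1: "\<forall>j. \<bar>\<phi>1 j\<bar> \<le> pi \<and> cis (\<phi>1 j) = cis (\<phi> j)" ..
  then have eq1: "root_poly m \<phi>1 = root_poly m \<phi>" by (simp add: root_poly_def)
  obtain \<psi> where \<psi>: "root_poly m \<psi> = root_poly m \<phi>1" "\<And>i j. i \<le> j \<Longrightarrow> j < m \<Longrightarrow> \<psi> i \<le> \<psi> j"
    "\<And>j. j < m \<Longrightarrow> \<exists>k<m. \<psi> j = \<phi>1 k"
    by (rule root_poly_sorted_exists[of m \<phi>1]) (rule that)
  have arc': "{-a..a} \<subseteq> sublevel m \<psi> h"
    using arc sublevel_cong[of m \<psi> \<phi>] \<psi>(1) eq1 by simp
  have in_arc: "\<bar>\<psi> j\<bar> < a" if j: "j < m" for j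
  proof (rule small_value_in_arc[OF arc'])
    show "\<bar>\<psi> j\<bar> \<le> pi" using \<psi>(3)[OF j] \<phi>1 by auto
    have "sine_prod m \<psi> (\<psi> j) = 0" using j by (auto simp: sine_prod_eq_0_iff)
    then show "\<bar>sine_prod m \<psi> (\<psi> j)\<bar> < h" using h_pos by simp
  qed
  have nz: "sine_prod m \<psi> (\<psi> j) = 0" if "j < m" for j
    using that by (auto simp: sine_prod_eq_0_iff)
  have "\<exists>s. s \<in> {-a..a} \<and> \<bar>sine_prod m \<psi> s\<bar> = h \<and> (1 \<le> i \<longrightarrow> \<psi> (i - 1) < s) \<and> (i < m \<longrightarrow> s < \<psi> i)"
    if i: "i \<le> m" for i
  proof -
    consider "i = 0" | "i = m" | "0 < i" "i < m" using i by linarith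
    then show ?thesis
    proof cases
      case 1
      then show ?thesis
        using abs_sine_prod_endpoints(2)[OF arc'] in_arc[of 0] a m by (intro exI[of _ "-a"]) auto
    next
      case 2
      then show ?thesis
        using abs_sine_prod_endpoints(1)[OF arc'] in_arc[of "m - 1"] a m by (intro exI[of _ a]) auto
    next
      case 3
      have "\<psi> (i - 1) \<le> \<psi> i" using \<psi>(2)[of "i - 1" i] 3 by simp
      moreover have i1: "i - 1 < m" "i - 1 \<noteq> i" using 3 by simp_all
      moreover from i1 have "-a < \<psi> (i - 1)" "\<psi> i < a"
        using in_arc[of "i - 1"] in_arc[of i] 3 by (auto simp del: One_nat_def)
      ultimately obtain s where s: "s \<in> {\<psi> (i - 1)..\<psi> i}" "h \<le> \<bar>sine_prod m \<psi> s\<bar>"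
        using large_value_between_roots[OF arc' i1(1) \<open>i < m\<close> i1(2)] by blast
      have sa: "s \<in> {-a..a}" using s(1) \<open>-a < \<psi> (i - 1)\<close> \<open>\<psi> i < a\<close> by auto
      then have "\<bar>sine_prod m \<psi> s\<bar> = h" using s(2) arc' by (force simp: sublevel_def)
      moreover have "s \<noteq> \<psi> (i - 1)" "s \<noteq> \<psi> i"
        using s(2) nz[OF \<open>i < m\<close>] nz[OF i1(1)] h_pos by auto
      ultimately show ?thesis using s(1) sa by (intro exI[of _ s]) auto
    qed
  qed
  then have "\<forall>i. \<exists>s. i \<le> m \<longrightarrow> s \<in> {-a..a} \<and> \<bar>sine_prod m \<psi> s\<bar> = h \<and> (1 \<le> i \<longrightarrow> \<psi> (i - 1) < s) \<and> (i < m \<longrightarrow> s < \<psi> i)"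
    by blast
  from choice[OF this] obtain s where
    s: "\<forall>i. i \<le> m \<longrightarrow> s i \<in> {-a..a} \<and> \<bar>sine_prod m \<psi> (s i)\<bar> = h \<and> (1 \<le> i \<longrightarrow> \<psi> (i - 1) < s i) \<and> (i < m \<longrightarrow> s i < \<psi> i)" ..
  have left: "\<psi> j < s i" if "j < i" "i \<le> m" for i j
  proof -
    have "\<psi> j \<le> \<psi> (i - 1)" using that by (intro \<psi>(2)) auto
    also have "\<psi> (i - 1) < s i" using s that by auto
    finally show ?thesis .
  qed
  have right: "s i < \<psi> j" if "i \<le> j" "j < m" for i j
  proof -
    have "s i < \<psi> i" using s that by auto
    also have "\<psi> i \<le> \<psi> j" using that by (intro \<psi>(2)) auto
    finally show ?thesis .
  qed
  have "sine_prod m \<psi> (s i) = (-1) ^ (m + i) * h" if i: "i \<le> m" for i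
  proof -
    have "\<bar>s i\<bar> \<le> a" using s i by auto
    have "sine_prod m \<psi> (s i) = (-1) ^ (m + i) * \<bar>sine_prod m \<psi> (s i)\<bar>"
    proof (rule sine_prod_sign[OF i])
      show "\<psi> j < s i \<and> s i < \<psi> j + 2 * pi" if "j < i" for j
        using left[OF that i] in_arc[of j] that i \<open>\<bar>s i\<bar> \<le> a\<close> a by auto
      show "s i < \<psi> j \<and> \<psi> j - 2 * pi < s i" if "i \<le> j" "j < m" for j
        using right[OF that] in_arc[of j] that \<open>\<bar>s i\<bar> \<le> a\<close> a by auto
    qed
    then show ?thesis using s i by simp
  qed
  moreover have "s i < s j" if "i < j" "j \<le> m" for i j
    using right[of i i] left[of i j] that by simp
  moreover have "\<psi> j \<in> {-pi<..<pi}" if "j < m" for j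
    using in_arc[OF that] a by auto
  ultimately have "alternating \<psi>"
    unfolding alternating_def using s arc' by blast
  then show thesis using that \<psi>(1) eq1 by simp
qed

end

section \<open>The Chebyshev configuration\<close>

fun cheb :: "nat \<Rightarrow> real poly" where
  "cheb 0 = 1"
| "cheb (Suc 0) = [:0, 1:]"
| "cheb (Suc (Suc n)) = [:0, 2:] * cheb (Suc n) - cheb n"

lemma poly_cheb_cos: "poly (cheb n) (cos x) = cos (real n * x)"
proof (induction n rule: cheb.induct)
  case (3 n)
  have 1: "real (Suc (Suc n)) * x = real (Suc n) * x + x" "real n * x = real (Suc n) * x - x"
    by (simp_all add: algebra_simps)
  have "cos (real (Suc (Suc n)) * x) = 2 * cos x * cos (real (Suc n) * x) - cos (real n * x)"
    unfolding 1 cos_add cos_diff by simp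
  then show ?case
    using 3 by simp
qed auto

lemma degree_coeff_cheb: "degree (cheb n) \<le> n \<and> coeff (cheb (Suc n)) (Suc n) = 2 ^ n"
proof (induction n rule: cheb.induct)
  case (3 n)
  have "degree (cheb (Suc (Suc n))) \<le> Suc (Suc n)"
  proof -
    have "degree ([:0, 2:] * cheb (Suc n)) \<le> degree [:0, 2 :: real:] + degree (cheb (Suc n))"
      by (rule degree_mult_le)
    then have "degree ([:0, 2:] * cheb (Suc n)) \<le> Suc (Suc n)" "degree (cheb n) \<le> Suc (Suc n)"
      using 3 by auto
    then show ?thesis unfolding cheb.simps by (rule degree_diff_le)
  qed
  moreover have "coeff (cheb (Suc (Suc (Suc n)))) (Suc (Suc (Suc n))) = 2 ^ Suc (Suc n)"
  proof -
    have "coeff (cheb (Suc n)) (Suc (Suc (Suc n))) = 0"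
      using 3 by (intro coeff_eq_0) auto
    moreover have "coeff ([:0, 2:] * cheb (Suc (Suc n))) (Suc (Suc (Suc n))) = 2 * coeff (cheb (Suc (Suc n))) (Suc (Suc n))"
      by (simp del: cheb.simps)
    ultimately show ?thesis
      using 3 unfolding cheb.simps(3)[of "Suc n"] coeff_diff by simp
  qed
  ultimately show ?case by blast
qed auto

lemma x_coef_angle:
  assumes "j < m"
  shows "0 < pi * (2 * real (Suc j) - 1) / (2 * real m)" "pi * (2 * real (Suc j) - 1) / (2 * real m) < pi"
proof -
  have "2 * real (Suc j) - 1 < 2 * real m" using assms by simp
  then have "pi * (2 * real (Suc j) - 1) < pi * (2 * real m)"
    by (intro mult_strict_left_mono) auto
  then show "pi * (2 * real (Suc j) - 1) / (2 * real m) < pi"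
    using assms by (simp add: pos_divide_less_eq)
  show "0 < pi * (2 * real (Suc j) - 1) / (2 * real m)"
    using assms by (intro divide_pos_pos mult_pos_pos) auto
qed

lemma x_coef_strict_antimono:
  assumes "i < j" "j < m"
  shows "x_coef (Suc j) m < x_coef (Suc i) m"
proof -
  have "pi * (2 * real (Suc i) - 1) / (2 * real m) < pi * (2 * real (Suc j) - 1) / (2 * real m)"
    using assms by (intro divide_strict_right_mono mult_strict_left_mono) auto
  then show ?thesis
    unfolding x_coef_def using x_coef_angle[of i m] x_coef_angle[of j m] assms
    by (intro cos_monotone_0_pi) auto
qed

text \<open>The Chebyshev polynomial of the first kind and the product over its \<open>m\<close>
  distinct zeros, scaled to leading coefficient \<open>2 ^ (m - 1)\<close>, differ by a polynomial
  of degree below \<open>m\<close> with \<open>m\<close> zeros. The factor 2 on the left turns this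
  power into \<open>2 ^ m\<close>.\<close>

lemma cos_mult_eq_prod:
  assumes m: "m \<ge> 1"
  shows "2 * cos (real m * x) = 2 ^ m * (\<Prod>j<m. cos x - x_coef (Suc j) m)"
proof -
  obtain n where n: "m = Suc n" using m by (cases m) auto
  define Q where "Q = (\<Prod>j<m. [:- x_coef (Suc j) m, 1:])"
  define R where "R = cheb m - smult (2 ^ n) Q"
  have dQ: "degree Q = m" unfolding Q_def by (subst degree_prod_sum_eq) auto
  moreover have "lead_coeff Q = 1" unfolding Q_def lead_coeff_prod by simp
  ultimately have cQ: "coeff Q m = 1" by simp
  have "degree R \<le> m"
    unfolding R_def using degree_coeff_cheb[of m] dQ by (intro degree_diff_le) auto
  moreover have "coeff R m = 0"
    using degree_coeff_cheb[of n] cQ by (simp add: R_def n del: cheb.simps)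
  ultimately have dR: "degree R < m"
    using m by (cases "degree R = m") (auto simp: eq_zero_or_degree_less)
  have zero: "poly R (x_coef (Suc j) m) = 0" if "j < m" for j
  proof -
    have "poly Q (x_coef (Suc j) m) = 0"
      using that by (auto simp: Q_def poly_prod)
    moreover have "poly (cheb m) (x_coef (Suc j) m) = 0"
    proof -
      have "real m * (pi * (2 * real (Suc j) - 1) / (2 * real m)) = real j * pi + pi / 2"
        using m by (simp add: field_simps)
      then have "poly (cheb m) (x_coef (Suc j) m) = cos (real j * pi + pi / 2)"
        by (simp only: x_coef_def poly_cheb_cos)
      also have "\<dots> = 0" by (simp add: cos_add)
      finally show ?thesis .
    qed
    ultimately show ?thesis by (simp add: R_def)
  qed
  have "R = 0"
  proof (rule ccontr)
    assume "R \<noteq> 0"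
    have "inj_on (\<lambda>j. x_coef (Suc j) m) {..<m}"
    proof (rule linorder_inj_onI)
      fix i j assume "i < j" "j \<in> {..<m}"
      then show "x_coef (Suc i) m \<noteq> x_coef (Suc j) m" using x_coef_strict_antimono[of i j m] by auto
    qed auto
    then have "m = card ((\<lambda>j. x_coef (Suc j) m) ` {..<m})" by (simp add: card_image)
    also have "\<dots> \<le> card {x. poly R x = 0}"
      using zero by (intro card_mono poly_roots_finite[OF \<open>R \<noteq> 0\<close>]) auto
    also have "\<dots> \<le> degree R" by (rule card_poly_roots_bound[OF \<open>R \<noteq> 0\<close>])
    finally show False using dR by simp
  qed
  then have "cheb m = smult (2 ^ n) Q" by (simp add: R_def)
  then have "cos (real m * x) = 2 ^ n * (\<Prod>j<m. cos x - x_coef (Suc j) m)"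
    unfolding poly_cheb_cos[symmetric] by (simp add: Q_def poly_prod)
  then show ?thesis by (simp add: n)
qed

text \<open>Each index is paired with its mirror image \<open>m - 1 - j\<close>, leaving the middle
  index when \<open>m\<close> is odd; the Chebyshev zeros and the extremal roots are symmetric under
  this reflection.\<close>

lemma prod_pairing:
  fixes f :: "nat \<Rightarrow> 'a::comm_monoid_mult"
  shows "(\<Prod>j<m. f j) = (\<Prod>j<m div 2. f j * f (m - 1 - j)) * (if odd m then f (m div 2) else 1)"
proof -
  define n where "n = m div 2"
  have "(\<Prod>j\<in>{m-n..<m}. f j) = (\<Prod>j<n. f (m - 1 - j))"
    by (rule prod.reindex_bij_witness[of _ "\<lambda>j. m - 1 - j" "\<lambda>j. m - 1 - j"]) (auto simp: n_def)
  moreover have "(\<Prod>j<m. f j) = (\<Prod>j<n. f j) * (\<Prod>j\<in>{m-n..<m}. f j) * (if odd m then f n else 1)"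
  proof (cases "odd m")
    case True
    then have mn: "m = Suc (2 * n)" by (auto simp: n_def)
    have "{..<m} = insert n ({..<n} \<union> {m-n..<m})" using mn by auto
    moreover have "prod f (insert n ({..<n} \<union> {m-n..<m})) = f n * prod f ({..<n} \<union> {m-n..<m})"
      using mn by (intro prod.insert) auto
    moreover have "prod f ({..<n} \<union> {m-n..<m}) = prod f {..<n} * prod f {m-n..<m}"
      using mn by (intro prod.union_disjoint) auto
    ultimately show ?thesis using True by (simp add: mult.commute)
  next
    case False
    then have mn: "m = 2 * n" by (auto simp: n_def)
    have "{..<m} = {..<n} \<union> {m-n..<m}" using mn by auto
    moreover have "prod f ({..<n} \<union> {m-n..<m}) = prod f {..<n} * prod f {m-n..<m}"
      using mn by (intro prod.union_disjoint) auto
    ultimately show ?thesis using False by simp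
  qed
  ultimately show ?thesis by (simp add: prod.distrib n_def)
qed

lemma x_coef_reflect:
  assumes "j < m"
  shows "x_coef (Suc (m - 1 - j)) m = - x_coef (Suc j) m"
proof -
  have "real (Suc (m - 1 - j)) = real m - real j" using assms by simp
  then have "pi * (2 * real (Suc (m - 1 - j)) - 1) / (2 * real m) = pi - pi * (2 * real (Suc j) - 1) / (2 * real m)"
    using assms by (simp only:) (simp add: field_simps)
  then show ?thesis by (simp only: x_coef_def cos_pi_minus)
qed

lemma x_coef_middle: "odd m \<Longrightarrow> x_coef (Suc (m div 2)) m = 0"
proof -
  assume "odd m"
  then obtain n where n: "m = Suc (2 * n)" by (auto elim: oddE)
  have "pi * (2 * real (Suc (m div 2)) - 1) / (2 * real m) = pi / 2"
    by (simp add: n field_simps)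
  then show ?thesis by (simp only: x_coef_def cos_pi_half)
qed

lemma abs_x_coef_le: "\<bar>x_coef k m\<bar> \<le> 1"
  by (simp add: x_coef_def)

text \<open>Chosen so that the sine of the half angle runs through the Chebyshev zeros scaled by
  \<open>sin (a / 2)\<close>. The zeros are numbered from 1, hence \<open>Suc j\<close>.\<close>

definition star_angle :: "nat \<Rightarrow> real \<Rightarrow> nat \<Rightarrow> real" where
  "star_angle m a j = 2 * arcsin (sin (a / 2) * x_coef (Suc j) m)"

lemma abs_sin_mult_x_coef_le: "\<bar>sin (a / 2) * x_coef k m\<bar> \<le> 1"
  unfolding abs_mult by (rule mult_le_one) (auto simp: abs_x_coef_le)

lemma sin_star_angle: "sin (star_angle m a j / 2) = sin (a / 2) * x_coef (Suc j) m"
  using abs_sin_mult_x_coef_le[of a "Suc j" m] by (simp add: star_angle_def abs_le_iff)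

lemma star_angle_reflect: "j < m \<Longrightarrow> star_angle m a (m - 1 - j) = - star_angle m a j"
  using abs_sin_mult_x_coef_le[of a "Suc j" m]
  by (simp only: star_angle_def x_coef_reflect) (simp add: abs_le_iff arcsin_minus)

lemma star_angle_middle: "odd m \<Longrightarrow> star_angle m a (m div 2) = 0"
  by (simp add: star_angle_def x_coef_middle)

lemma sin_diff_mult_sin_add: "sin (x - y) * sin (x + y) = (sin x)\<^sup>2 - (sin y)\<^sup>2" for x y :: real
proof -
  have "sin (x - y) * sin (x + y) = (sin x)\<^sup>2 * (cos y)\<^sup>2 - (cos x)\<^sup>2 * (sin y)\<^sup>2"
    by (simp add: sin_diff sin_add power2_eq_square algebra_simps)
  then show ?thesis
    by (simp add: cos_squared_eq algebra_simps)
qed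

text \<open>The factors agree only in pairs: for opposite roots,
  \<open>sin (x - y) * sin (x + y)\<close> is a difference of squared sines, which splits again into
  two factors linear in \<open>sin (t / 2)\<close>.\<close>

lemma sine_prod_star: "sine_prod m (star_angle m a) t = 2 ^ m * (\<Prod>j<m. sin (t / 2) - sin (a / 2) * x_coef (Suc j) m)"
proof -
  have "sine_prod m (star_angle m a) t = (\<Prod>j<m. 2 * (sin (t / 2) - sin (a / 2) * x_coef (Suc j) m))"
    unfolding sine_prod_def
  proof (subst (1 2) prod_pairing, rule arg_cong2[where f = "(*)"], rule prod.cong)
    fix j assume "j \<in> {..<m div 2}"
    then have j: "j < m" by auto
    have "2 * sin ((t - star_angle m a j) / 2) * (2 * sin ((t - star_angle m a (m - 1 - j)) / 2))
      = 4 * (sin (t / 2 - star_angle m a j / 2) * sin (t / 2 + star_angle m a j / 2))"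
      unfolding star_angle_reflect[OF j] by (simp add: add_divide_distrib diff_divide_distrib)
    also have "\<dots> = 2 * (sin (t / 2) - sin (a / 2) * x_coef (Suc j) m) * (2 * (sin (t / 2) - sin (a / 2) * x_coef (Suc (m - 1 - j)) m))"
      unfolding sin_diff_mult_sin_add sin_star_angle x_coef_reflect[OF j]
      by (simp add: power2_eq_square algebra_simps)
    finally show "2 * sin ((t - star_angle m a j) / 2) * (2 * sin ((t - star_angle m a (m - 1 - j)) / 2))
      = 2 * (sin (t / 2) - sin (a / 2) * x_coef (Suc j) m) * (2 * (sin (t / 2) - sin (a / 2) * x_coef (Suc (m - 1 - j)) m))" .
  qed (auto simp: star_angle_middle x_coef_middle)
  then show ?thesis by (simp only: prod.distrib prod_constant card_lessThan)
qed

text \<open>Opposite angles give conjugate roots, whose quadratic factor has middle coefficient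
  minus twice the cosine; the double-angle formula identifies this cosine with
  \<open>a_coef\<close>.\<close>

lemma root_poly_star: "root_poly m (star_angle m a) = P_star m a"
proof -
  have pair: "[:- cis (star_angle m a j), 1:] * [:- cis (star_angle m a (m - 1 - j)), 1:]
    = [:1, - 2 * complex_of_real (a_coef (Suc j) m a), 1:]" if "j \<in> {..<m div 2}" for j
  proof -
    have j: "j < m" using that by auto
    have "cos (star_angle m a j) = a_coef (Suc j) m a"
      using cos_double_sin[of "star_angle m a j / 2"]
      by (simp add: sin_star_angle a_coef_def power_mult_distrib mult.commute mult.left_commute)
    moreover have "cis (star_angle m a j) + cis (- star_angle m a j) = 2 * complex_of_real (cos (star_angle m a j))"
      by (simp add: complex_eq_iff)
    ultimately have "- cis (star_angle m a j) - cis (- star_angle m a j) = - 2 * complex_of_real (a_coef (Suc j) m a)"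
      by (simp add: algebra_simps)
    moreover have "cis (star_angle m a j) * cis (- star_angle m a j) = 1"
      by (simp add: cis_mult)
    ultimately show ?thesis
      unfolding star_angle_reflect[OF j] by (simp add: algebra_simps)
  qed
  have "root_poly m (star_angle m a)
    = (\<Prod>j<m div 2. [:1, - 2 * complex_of_real (a_coef (Suc j) m a), 1:]) * (if odd m then [:- cis (star_angle m a (m div 2)), 1:] else 1)"
    unfolding root_poly_def by (subst prod_pairing) (simp only: pair cong: prod.cong)
  also have "(\<Prod>j<m div 2. [:1, - 2 * complex_of_real (a_coef (Suc j) m a), 1:]) = S_poly (m div 2) m a"
    by (simp add: S_poly_def prod.atLeast1_atMost_eq)
  finally show ?thesis
    by (auto simp: P_star_def star_angle_middle mult.commute)
qed

section \<open>Extremal polynomials\<close>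

context extremal_arc
begin

text \<open>Under this substitution every factor acquires \<open>sin (a / 2)\<close>, and what
  remains is the factored Chebyshev polynomial at \<open>cos x\<close>.\<close>

lemma sine_prod_star_cos:
  assumes "sin (t / 2) = sin (a / 2) * cos x"
  shows "sine_prod m (star_angle m a) t = h * cos (real m * x)"
proof -
  have "sine_prod m (star_angle m a) t = 2 ^ m * (\<Prod>j<m. sin (a / 2) * (cos x - x_coef (Suc j) m))"
    unfolding sine_prod_star assms by (simp add: right_diff_distrib)
  also have "\<dots> = sin (a / 2) ^ m * (2 ^ m * (\<Prod>j<m. cos x - x_coef (Suc j) m))"
    by (simp only: prod.distrib prod_constant card_lessThan mult.left_commute)
  also have "\<dots> = h * cos (real m * x)"
    unfolding cos_mult_eq_prod[OF m, symmetric] h by simp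
  finally show ?thesis .
qed

lemma sin_half_a: "0 < sin (a / 2)" "sin (a / 2) < 1"
proof -
  show "0 < sin (a / 2)" using a by (intro sin_gt_zero) auto
  have "sin (a / 2) < sin (pi / 2)" using a by (intro sin_monotone_2pi) auto
  then show "sin (a / 2) < 1" by simp
qed

lemma arc_param:
  assumes "\<bar>t\<bar> \<le> a"
  obtains x where "0 \<le> x" "x \<le> pi" "sin (t / 2) = sin (a / 2) * cos x"
proof -
  have 1: "sin (t / 2) \<le> sin (a / 2)" "sin (- (a / 2)) \<le> sin (t / 2)"
    using assms a by (auto simp del: sin_minus intro!: sin_monotone_2pi_le)
  then have 2: "sin (t / 2) / sin (a / 2) \<in> {-1..1}"
    using sin_half_a(1) by (auto simp: field_simps)
  show thesis
  proof (rule that[of "arccos (sin (t / 2) / sin (a / 2))"])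
    show "sin (t / 2) = sin (a / 2) * cos (arccos (sin (t / 2) / sin (a / 2)))"
      using 2 sin_half_a(1) by simp
  qed (use 2 in \<open>auto intro: arccos_lbound arccos_ubound\<close>)
qed

lemma star_arc: "{-a..a} \<subseteq> sublevel m (star_angle m a) h"
proof
  fix t assume "t \<in> {-a..a}"
  then have "\<bar>t\<bar> \<le> a" by auto
  then obtain x where "sin (t / 2) = sin (a / 2) * cos x" by (rule arc_param)
  then have "sine_prod m (star_angle m a) t = h * cos (real m * x)" by (rule sine_prod_star_cos)
  moreover have "h * \<bar>cos (real m * x)\<bar> \<le> h * 1" using h_pos by (intro mult_left_mono) auto
  ultimately show "t \<in> sublevel m (star_angle m a) h"
    using h_pos by (simp add: sublevel_def abs_mult)
qed

text \<open>The Chebyshev extremal points \<open>cos (k * pi / m)\<close> carried to the arc. They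
  decrease in \<open>k\<close>, so the alternation takes them as
  \<open>node (m - i)\<close>.\<close>

definition node :: "nat \<Rightarrow> real" where
  "node k = 2 * arcsin (sin (a / 2) * cos (real k * pi / real m))"

lemma abs_sin_half_a_mult: "\<bar>sin (a / 2) * cos y\<bar> \<le> sin (a / 2)"
proof -
  have "\<bar>sin (a / 2)\<bar> * \<bar>cos y\<bar> \<le> \<bar>sin (a / 2)\<bar> * 1"
    by (intro mult_left_mono) auto
  then show ?thesis using sin_half_a(1) by (simp add: abs_mult)
qed

lemma node_in_arc: "node k \<in> {-a..a}"
proof -
  let ?y = "sin (a / 2) * cos (real k * pi / real m)"
  have y: "- sin (a / 2) \<le> ?y" "?y \<le> sin (a / 2)"
    using abs_sin_half_a_mult[of "real k * pi / real m"] by (auto simp: abs_le_iff)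
  have as: "arcsin (sin (a / 2)) = a / 2" using a by (intro arcsin_sin) auto
  have "arcsin ?y \<le> arcsin (sin (a / 2))" "arcsin (- sin (a / 2)) \<le> arcsin ?y"
    using y sin_half_a by (intro arcsin_le_arcsin; linarith)+
  then show ?thesis
    using as sin_half_a by (simp add: node_def arcsin_minus)
qed

lemma sin_node: "sin (node k / 2) = sin (a / 2) * cos (real k * pi / real m)"
proof -
  have "\<bar>sin (a / 2) * cos (real k * pi / real m)\<bar> \<le> 1"
    using abs_sin_half_a_mult[of "real k * pi / real m"] sin_half_a(2) by linarith
  then show ?thesis by (simp add: node_def abs_le_iff)
qed

lemma sine_prod_node: "sine_prod m (star_angle m a) (node k) = h * (-1) ^ k"
proof -
  have "real m * (real k * pi / real m) = real k * pi" using m by simp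
  then show ?thesis
    using sine_prod_star_cos[OF sin_node[of k]] by (simp add: cos_npi)
qed

lemma node_antimono:
  assumes "i < j" "j \<le> m"
  shows "node j < node i"
proof -
  have "real i * pi / real m < real j * pi / real m"
    using assms by (intro divide_strict_right_mono mult_strict_right_mono) auto
  moreover have "real j * pi / real m \<le> pi"
    using assms m by (simp add: pos_divide_le_eq)
  ultimately have "cos (real j * pi / real m) < cos (real i * pi / real m)"
    by (intro cos_monotone_0_pi) auto
  then have "sin (node j / 2) < sin (node i / 2)"
    unfolding sin_node using sin_half_a(1) by simp
  show ?thesis
  proof (rule ccontr)
    assume "\<not> node j < node i"
    then have "sin (node i / 2) \<le> sin (node j / 2)"
      using node_in_arc[of i] node_in_arc[of j] a by (intro sin_monotone_2pi_le) auto
    then show False using \<open>sin (node j / 2) < sin (node i / 2)\<close> by simp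
  qed
qed

lemma star_alternating: "alternating (star_angle m a)"
  unfolding alternating_def
proof (intro conjI allI impI exI[of _ "\<lambda>i. node (m - i)"])
  show "star_angle m a j \<in> {-pi<..<pi}" if "j < m" for j
  proof -
    let ?y = "sin (a / 2) * x_coef (Suc j) m"
    have "\<bar>?y\<bar> \<le> sin (a / 2)"
      unfolding x_coef_def by (rule abs_sin_half_a_mult)
    then have "- 1 < ?y" "?y < 1" using sin_half_a(2) by (auto simp: abs_le_iff)
    then show ?thesis
      using arcsin_lt_bounded[of ?y] by (auto simp: star_angle_def)
  qed
  show "{-a..a} \<subseteq> sublevel m (star_angle m a) h" by (rule star_arc)
  show "node (m - i) \<in> {-a..a}" for i by (rule node_in_arc)
  show "sine_prod m (star_angle m a) (node (m - i)) = (-1) ^ (m + i) * h" if "i \<le> m" for i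
  proof -
    have "m + i = (m - i) + 2 * i" using that by simp
    then have "(-1 :: real) ^ (m + i) = (-1) ^ (m - i)" by (simp only: power_add power_mult) simp
    then show ?thesis by (simp add: sine_prod_node)
  qed
  show "node (m - i) < node (m - j)" if "i < j" "j \<le> m" for i j
    using that by (intro node_antimono) auto
qed

text \<open>For \<open>x\<close> in \<open>[0, pi]\<close>, \<open>|cos (m * x)| = 1\<close> only at
  multiples of \<open>pi / m\<close>, which are the nodes. Passing to the strict inequality thus
  costs only finitely many points of the arc, a null set.\<close>

lemma star_arc_strict: "{-a..a} - node ` {..m} \<subseteq> {t. \<bar>sine_prod m (star_angle m a) t\<bar> < h}"
proof
  fix t assume t: "t \<in> {-a..a} - node ` {..m}"
  then have ta: "\<bar>t\<bar> \<le> a" by auto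
  then obtain x where x: "0 \<le> x" "x \<le> pi" "sin (t / 2) = sin (a / 2) * cos x" by (rule arc_param)
  have T: "sine_prod m (star_angle m a) t = h * cos (real m * x)" using x(3) by (rule sine_prod_star_cos)
  have "\<bar>cos (real m * x)\<bar> \<noteq> 1"
  proof
    assume "\<bar>cos (real m * x)\<bar> = 1"
    then have "(cos (real m * x))\<^sup>2 = 1" by (metis power2_abs one_power2)
    then have "sin (real m * x) = 0" by (simp add: cos_squared_eq)
    then obtain k :: int where k: "real m * x = of_int k * pi"
      by (auto simp: sin_zero_iff_int2)
    have "0 \<le> real_of_int k * pi" "real_of_int k * pi \<le> real m * pi"
      unfolding k[symmetric] using x m by (auto intro!: mult_left_mono)
    then have "0 \<le> real_of_int k" "real_of_int k \<le> real m"
      using mult_le_cancel_right_pos[OF pi_gt_zero, of 0 "real_of_int k"]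
        mult_le_cancel_right_pos[OF pi_gt_zero, of "real_of_int k" "real m"] by simp_all
    then have k0: "0 \<le> k" "k \<le> int m" by linarith+
    then have x_eq: "x = real (nat k) * pi / real m"
      using k k0 m by (simp add: field_simps)
    have "sin (t / 2) = sin (node (nat k) / 2)" by (simp add: sin_node x(3) x_eq)
    moreover have "t / 2 = arcsin (sin (t / 2))" using ta a by (intro arcsin_sin[symmetric]) auto
    moreover have "node (nat k) / 2 = arcsin (sin (node (nat k) / 2))"
      using node_in_arc[of "nat k"] a by (intro arcsin_sin[symmetric]) auto
    ultimately have "t / 2 = node (nat k) / 2" by metis
    then have "t = node (nat k)" by simp
    moreover have "nat k \<in> {..m}" using k0 by auto
    ultimately show False using t by blast
  qed
  moreover have "\<bar>cos (real m * x)\<bar> \<le> 1" by simp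
  ultimately have "\<bar>cos (real m * x)\<bar> < 1" by linarith
  then have "h * \<bar>cos (real m * x)\<bar> < h * 1" using h_pos by (intro mult_strict_left_mono) auto
  then show "t \<in> {t. \<bar>sine_prod m (star_angle m a) t\<bar> < h}"
    using h_pos by (simp add: T abs_mult)
qed

end

section \<open>From sublevel sets to \<open>mes_ge\<close> and \<open>delta\<close>\<close>

definition strict_sublevel :: "nat \<Rightarrow> (nat \<Rightarrow> real) \<Rightarrow> real \<Rightarrow> real set" where
  "strict_sublevel m \<phi> h = {t. \<bar>sine_prod m \<phi> t\<bar> < h}"

lemma strict_sublevel_measurable [measurable]: "strict_sublevel m \<phi> h \<in> sets lebesgue"
proof -
  have "open (strict_sublevel m \<phi> h)"
    unfolding strict_sublevel_def by (intro open_Collect_less continuous_intros)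
  then show ?thesis by simp
qed

lemma strict_sublevel_lmeasurable: "strict_sublevel m \<phi> h \<inter> {x..<y} \<in> lmeasurable"
  by (auto intro!: bounded_set_imp_lmeasurable bounded_Int)

lemma mes_ge_root_poly:
  "mes_ge (root_poly m \<phi>) h = 2 * pi - measure lebesgue (strict_sublevel m \<phi> h \<inter> {0..<2*pi})"
proof -
  have "{t \<in> torus. h \<le> cmod (poly (root_poly m \<phi>) (cis t))} = {0..<2*pi} - strict_sublevel m \<phi> h \<inter> {0..<2*pi}"
    by (auto simp: torus_def cmod_root_poly_cis strict_sublevel_def)
  moreover have "measure lebesgue ({0..<2*pi} - strict_sublevel m \<phi> h \<inter> {0..<2*pi})
    = measure lebesgue {0..<2*pi} - measure lebesgue (strict_sublevel m \<phi> h \<inter> {0..<2*pi})"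
    by (rule measurable_measure_Diff) (auto intro!: bounded_set_imp_lmeasurable)
  ultimately show ?thesis by (simp add: mes_ge_def)
qed

lemma strict_sublevel_measure_le: "measure lebesgue (strict_sublevel m \<phi> h \<inter> {0..<2*pi}) \<le> sub_mes m \<phi> h"
  unfolding sub_mes_def
proof (rule measure_mono_fmeasurable)
  show "strict_sublevel m \<phi> h \<inter> {0..<2*pi} \<subseteq> sublevel m \<phi> h \<inter> {0..<2*pi}"
    by (auto simp: strict_sublevel_def sublevel_def)
  show "strict_sublevel m \<phi> h \<inter> {0..<2*pi} \<in> sets lebesgue"
    by (rule fmeasurableD[OF strict_sublevel_lmeasurable])
qed simp

lemma strict_sublevel_window:
  "measure lebesgue (strict_sublevel m \<phi> h \<inter> {x..<x+2*pi}) = measure lebesgue (strict_sublevel m \<phi> h \<inter> {0..<2*pi})"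
  by (rule periodic_measure_shift[OF strict_sublevel_measurable]) (auto simp: strict_sublevel_def sine_prod_periodic)

lemma mes_ge_rotate: "mes_ge (root_poly m (\<lambda>j. \<phi> j - u)) h = mes_ge (root_poly m \<phi>) h"
proof -
  have "(+) u ` (strict_sublevel m (\<lambda>j. \<phi> j - u) h \<inter> {0..<2*pi}) = strict_sublevel m \<phi> h \<inter> {u..<u+2*pi}"
    by (auto simp: strict_sublevel_def sine_prod_minus add.commute intro!: image_eqI[of _ _ "t - u" for t])
  then have "measure lebesgue (strict_sublevel m (\<lambda>j. \<phi> j - u) h \<inter> {0..<2*pi})
    = measure lebesgue (strict_sublevel m \<phi> h \<inter> {u..<u+2*pi})"
    by (metis measure_translation)
  then show ?thesis
    by (simp only: mes_ge_root_poly strict_sublevel_window)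
qed

lemma poly_root_poly_rotate:
  "poly (root_poly m \<phi>) z = cis (real m * u) * poly (root_poly m (\<lambda>j. \<phi> j - u)) (z * cis (- u))"
proof -
  have "z - cis (\<phi> j) = cis u * (z * cis (- u) - cis (\<phi> j - u))" for j
  proof -
    have "cis u * cis (- u) = 1" "cis u * cis (\<phi> j - u) = cis (\<phi> j)" by (simp_all add: cis_mult)
    then show ?thesis by (simp add: right_diff_distrib mult.left_commute)
  qed
  then show ?thesis
    by (simp add: poly_root_poly prod.distrib Complex.DeMoivre)
qed

context extremal_arc
begin

lemma mes_ge_ge: "2 * pi - 2 * a \<le> mes_ge (root_poly m \<phi>) h"
  using strict_sublevel_measure_le[of m \<phi> h] sub_mes_le_extremal[OF m a h, of \<phi>]
  by (simp add: mes_ge_root_poly)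

lemma mes_ge_star: "mes_ge (root_poly m (star_angle m a)) h = 2 * pi - 2 * a"
proof -
  have null: "node ` {..m} \<in> null_sets lebesgue"
    using negligible_finite[of "node ` {..m}"] by (simp add: negligible_iff_null_sets)
  have "2 * a = measure lebesgue ({-a..a} - node ` {..m})"
    using a by (subst measure_Diff_null_set[OF _ null]) auto
  also have "\<dots> \<le> measure lebesgue (strict_sublevel m (star_angle m a) h \<inter> {-pi..<-pi+2*pi})"
  proof (rule measure_mono_fmeasurable)
    show "{-a..a} - node ` {..m} \<subseteq> strict_sublevel m (star_angle m a) h \<inter> {-pi..<-pi+2*pi}"
      using star_arc_strict a by (auto simp: strict_sublevel_def)
    show "{-a..a} - node ` {..m} \<in> sets lebesgue"
      using null by auto
  qed (rule strict_sublevel_lmeasurable)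
  also have "\<dots> = measure lebesgue (strict_sublevel m (star_angle m a) h \<inter> {0..<2*pi})"
    by (rule strict_sublevel_window)
  finally have "mes_ge (root_poly m (star_angle m a)) h \<le> 2 * pi - 2 * a"
    by (simp add: mes_ge_root_poly)
  then show ?thesis using mes_ge_ge[of "star_angle m a"] by linarith
qed

lemma delta_eq: "delta m h = 2 * pi - 2 * a"
  unfolding delta_def unit_circle_polys_eq
proof (rule cInf_eq_minimum)
  show "2 * pi - 2 * a \<in> (\<lambda>P. mes_ge P h) ` range (root_poly m)"
    unfolding mes_ge_star[symmetric] by (intro imageI rangeI)
  show "2 * pi - 2 * a \<le> x" if "x \<in> (\<lambda>P. mes_ge P h) ` range (root_poly m)" for x
    using that mes_ge_ge by auto
qed

lemma h_less_2: "h < 2"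
proof -
  have "sin (a / 2) ^ m \<le> sin (a / 2) ^ 1" using sin_half_a m by (intro power_decreasing) auto
  then have "sin (a / 2) ^ m < 1" using sin_half_a by simp
  then show ?thesis by (simp add: h)
qed

text \<open>The strict sublevel set has measure \<open>2 * a\<close>, which forces the same measure
  for \<open>sublevel\<close>. The sharp bound is then an equality, so after a rotation the arc is
  contained, alternation follows, and uniqueness identifies the polynomial.\<close>

lemma extremal_rotation:
  assumes "mes_ge (root_poly m \<phi>) h = 2 * pi - 2 * a"
  shows "\<exists>u. root_poly m (\<lambda>j. \<phi> j - u) = P_star m a"
proof -
  have eq: "sub_mes m \<phi> h = 2 * a"
    using assms strict_sublevel_measure_le[of m \<phi> h] sub_mes_le_extremal[OF m a h, of \<phi>]
    by (simp add: mes_ge_root_poly)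
  then have "sin (sub_mes m \<phi> h / 4) ^ m = h / 2" by (simp add: h)
  then obtain u where "{- sub_mes m \<phi> h / 2 <..< sub_mes m \<phi> h / 2} \<subseteq> sublevel m (\<lambda>j. \<phi> j - u) h"
    by (rule extremal_contains_arc[OF m h_pos h_less_2])
  then have "{-a<..<a} \<subseteq> sublevel m (\<lambda>j. \<phi> j - u) h" by (simp add: eq)
  \<comment> \<open>The equality case yields only the open arc; closedness of the sublevel set adds
    the endpoints.\<close>
  then have "closure {-a<..<a} \<subseteq> sublevel m (\<lambda>j. \<phi> j - u) h"
    by (intro closure_minimal closed_sublevel)
  then have "{-a..a} \<subseteq> sublevel m (\<lambda>j. \<phi> j - u) h"
    using a by simp
  then obtain \<psi> where \<psi>: "alternating \<psi>" "root_poly m \<psi> = root_poly m (\<lambda>j. \<phi> j - u)"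
    by (rule alternating_exists)
  have "root_poly m \<psi> = root_poly m (star_angle m a)"
    by (rule alternating_unique[OF \<psi>(1) star_alternating])
  then show ?thesis using \<psi>(2) root_poly_star by auto
qed

lemma extremal_iff:
  "mes_ge (root_poly m \<phi>) h = delta m h \<longleftrightarrow>
    (\<exists>\<theta>::real. \<forall>z. poly (root_poly m \<phi>) z = cis (real m * \<theta>) * poly (P_star m a) (z * cis (- \<theta>)))"
proof
  assume "mes_ge (root_poly m \<phi>) h = delta m h"
  then obtain u where "root_poly m (\<lambda>j. \<phi> j - u) = P_star m a"
    using extremal_rotation[of \<phi>] by (auto simp: delta_eq)
  then show "\<exists>\<theta>::real. \<forall>z. poly (root_poly m \<phi>) z = cis (real m * \<theta>) * poly (P_star m a) (z * cis (- \<theta>))"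
    using poly_root_poly_rotate[of m \<phi> _ u] by auto
next
  assume "\<exists>\<theta>::real. \<forall>z. poly (root_poly m \<phi>) z = cis (real m * \<theta>) * poly (P_star m a) (z * cis (- \<theta>))"
  then obtain \<theta> where \<theta>: "\<And>z. poly (root_poly m \<phi>) z = cis (real m * \<theta>) * poly (P_star m a) (z * cis (- \<theta>))"
    by blast
  \<comment> \<open>Angles realizing the given rotation of \<open>P_star\<close>: the polynomial
    values then coincide, and rotation invariance of \<open>mes_ge\<close> finishes.\<close>
  define \<psi> where "\<psi> = (\<lambda>j. star_angle m a j + \<theta>)"
  have \<psi>_rot: "(\<lambda>j. \<psi> j - \<theta>) = star_angle m a" by (simp add: \<psi>_def)
  have "poly (root_poly m \<phi>) z = poly (root_poly m \<psi>) z" for z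
    unfolding \<theta> poly_root_poly_rotate[of m \<psi> z \<theta>] \<psi>_rot root_poly_star ..
  then have "mes_ge (root_poly m \<phi>) h = mes_ge (root_poly m \<psi>) h"
    by (simp add: mes_ge_def)
  also have "\<dots> = mes_ge (root_poly m (\<lambda>j. \<psi> j - \<theta>)) h" by (rule mes_ge_rotate[symmetric])
  also have "\<dots> = delta m h" unfolding \<psi>_rot mes_ge_star delta_eq ..
  finally show "mes_ge (root_poly m \<phi>) h = delta m h" .
qed

lemma arccos_eq: "4 * arccos ((h / 2) powr (1 / real m)) = 2 * pi - 2 * a"
proof -
  have "(h / 2) powr (1 / real m) = (sin (a / 2) powr real m) powr (1 / real m)"
    using sin_half_a(1) by (simp add: h powr_realpow)
  also have "\<dots> = sin (a / 2)" using m sin_half_a(1) by (simp add: powr_powr)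
  also have "\<dots> = cos (pi / 2 - a / 2)" by (simp add: cos_diff)
  finally have "arccos ((h / 2) powr (1 / real m)) = pi / 2 - a / 2"
    using a by (simp only:) (rule arccos_cos, auto)
  then show ?thesis by simp
qed

end

theorem theorem6:
  fixes m :: nat and h \<alpha> :: real
  assumes "m \<ge> 1" and "0 < h" and "h < 2"
    and "0 < \<alpha>" and "\<alpha> < pi" and "h = 2 * (sin (\<alpha> / 2)) ^ m"
  shows "delta m h = 4 * arccos ((h / 2) powr (1 / real m))
    \<and> (\<forall>P \<in> unit_circle_polys m.
          mes_ge P h = delta m h \<longleftrightarrow>
          (\<exists>\<theta>::real. \<forall>z. poly P z = cis (real m * \<theta>) * poly (P_star m \<alpha>) (z * cis (- \<theta>))))"
proof -
  interpret extremal_arc m \<alpha> h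
    by (rule extremal_arc.intro) (use assms in auto)
  show ?thesis
    using delta_eq arccos_eq extremal_iff by (auto simp only: unit_circle_polys_eq)
qed

end
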